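(* Consider either of the two settings described in the context (non-layered or two-layered background medium $\gamma_0$), and let $I_\tau$ and $\tilde I_\tau$ be the two indicator functions defined there. Then there exists a constant $C>0$, independent of $\tau$, such that $$|\tilde I_\tau-I_\tau|\le C\tau^{-1}e^{-\tau T}\|f\|_{L^2(\mathbb{R}^3)}^2\qquad(\tau\ge1).$$
   Context: $I_3$ is the $3\times3$ unit matrix; inequalities between symmetric matrices are in the sense of quadratic forms; for a symmetric matrix-valued $\sigma\in L^\infty(\mathbb{R}^3)$, $L_\sigma u=\mathrm{div}(\sigma\nabla_xu)$; $\mathbb{R}^3_\pm=\{x\in\mathbb{R}^3:\pm x_3>0\}$. In both settings $\gamma$ is a real symmetric matrix-valued function with entries in $L^\infty(\mathbb{R}^3)$ and $\gamma(x)\ge c_0I_3$ a.e. for some $c_0>0$, and $D$ is a nonempty bounded measurable set. Setting 1 (non-layered): $\gamma_0(x)=I_3$ for all $x$; $\mathbb{R}^3\setminus D$ is connected; $\gamma=I_3$ on $\mathbb{R}^3\setminus D$; for some $c>0$, either $\gamma-I_3\ge cI_3$ a.e. in $D$ or $I_3-\gamma\ge cI_3$ a.e. in $D$; $B$ is an open set with $\overline B\cap\overline D=\emptyset$. Setting 2 (two-layered): $\gamma_0(x)=\gamma_\pm I_3$ for $\pm x_3>0$, with constants $\gamma_+,\gamma_->0$, $\gamma_+\neq\gamma_-$; $\overline D\subset\mathbb{R}^3_-$ and $\mathbb{R}^3_-\setminus D$ is connected; $\gamma=\gamma_+I_3$ on $\mathbb{R}^3_+$ and $\gamma=\gamma_-I_3$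 on $\mathbb{R}^3_-\setminus D$; for some $c>0$, either $\gamma-\gamma_-I_3\ge cI_3$ a.e. in $D$ or $\gamma_-I_3-\gamma\ge cI_3$ a.e. in $D$; $B$ is an open set with $\overline B\subset\mathbb{R}^3_+$. In both settings the real-valued $f\in L^2(\mathbb{R}^3)$ satisfies $\mathrm{supp} f\subset\overline B$ and, for some $c_1>0$, either $f\ge c_1$ on $B$ or $-f\ge c_1$ on $B$. For $T>0$ fixed, $u$ (resp. $u_0$) is the unique weak solution of $(\partial_t^2-L_\sigma)u=0$ in $(0,T)\times\mathbb{R}^3$, $u(0,x)=0$, $\partial_tu(0,x)=f(x)$ on $\mathbb{R}^3$, with $\sigma=\gamma$ (resp. $\sigma=\gamma_0$): it lies in $L^2(0,T;H^1(\mathbb{R}^3))$ with first time derivative in $L^2(0,T;L^2(\mathbb{R}^3))$ and second time derivative in $L^2(0,T;(H^1(\mathbb{R}^3))')$, satisfies $\langle\partial_t^2u(t,\cdot),\phi\rangle+\int_{\mathbb{R}^3}\sigma\nabla_xu(t,x)\cdot\nabla_x\phi(x)\,dx=0$ for a.e. $t\in(0,T)$ and all $\phi\in H^1(\mathbb{R}^3)$, and the initial conditions hold in the usual sense. For $\tau\ge1$ put $w(x;\tau)=\int_0^Te^{-\tau t}u(t,x)\,dt$ and $\tilde v(x;\tau)=\int_0^Te^{-\tau t}u_0(t,x)\,dt$, and let $v(\cdot;\tau)$ be the $L^2$-solution (weak solution in $H^1(\mathbb{R}^3)$) of $(L_{\gamma_0}-\tau^2)v+f=0$ in $\mathbb{R}^3$.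 The indicator functions are $$I_\tau=\int_{\mathbb{R}^3}f(x)(w(x;\tau)-v(x;\tau))\,dx,\qquad \tilde I_\tau=\int_0^T\!\!\int_{\mathbb{R}^3}e^{-\tau t}f(x)(u(t,x)-u_0(t,x))\,dx\,dt=\int_{\mathbb{R}^3}f(x)(w(x;\tau)-\tilde v(x;\tau))\,dx.$$ *)

theory Defs
  imports "HOL-Analysis.Analysis"
begin

text \<open>
  Elements of function spaces are represented by actual functions (not equivalence classes);
  everything imposed on them is an almost-everywhere or an integral condition.  Measurability is
  Lebesgue measurability throughout.
\<close>

section \<open>Square integrable functions and the Sobolev space $H^1$\<close>

definition L2_fun :: "'a measure \<Rightarrow> ('a \<Rightarrow> 'b::euclidean_space) \<Rightarrow> bool" where
  "L2_fun M p \<longleftrightarrow> p \<in> borel_measurable M \<and> integrable M (\<lambda>x. (norm (p x))\<^sup>2)"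

definition L2_norm :: "('a::euclidean_space \<Rightarrow> real) \<Rightarrow> real" where
  "L2_norm p = sqrt (LINT x|lebesgue. (p x)\<^sup>2)"

primrec C_k :: "nat \<Rightarrow> ('a::euclidean_space \<Rightarrow> real) \<Rightarrow> bool" where
  "C_k 0 \<phi> \<longleftrightarrow> continuous_on UNIV \<phi>"
| "C_k (Suc k) \<phi> \<longleftrightarrow> (\<forall>x. \<phi> differentiable (at x)) \<and>
     (\<forall>b\<in>Basis. C_k k (\<lambda>x. frechet_derivative \<phi> (at x) b))"

definition test_function :: "'a::euclidean_space set \<Rightarrow> ('a \<Rightarrow> real) \<Rightarrow> bool" where
  "test_function S \<phi> \<longleftrightarrow> (\<forall>k. C_k k \<phi>) \<and>
     compact (closure {x. \<phi> x \<noteq> 0}) \<and> closure {x. \<phi> x \<noteq> 0} \<subseteq> S"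

definition weak_gradient :: "('a::euclidean_space \<Rightarrow> real) \<Rightarrow> ('a \<Rightarrow> 'a) \<Rightarrow> bool" where
  "weak_gradient p g \<longleftrightarrow> (\<forall>\<phi>. test_function UNIV \<phi> \<longrightarrow> (\<forall>b\<in>Basis.
     (LINT x|lebesgue. p x * frechet_derivative \<phi> (at x) b)
       = - (LINT x|lebesgue. (g x \<bullet> b) * \<phi> x)))"

text \<open>\<open>H1 p g\<close>: \<open>p\<close> belongs to $H^1$ and \<open>g\<close> is its weak gradient
  (which is unique up to null sets).\<close>

definition H1 :: "('a::euclidean_space \<Rightarrow> real) \<Rightarrow> ('a \<Rightarrow> 'a) \<Rightarrow> bool" where
  "H1 p g \<longleftrightarrow> L2_fun lebesgue p \<and> L2_fun lebesgue g \<and> weak_gradient p g"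

definition H1_norm :: "('a::euclidean_space \<Rightarrow> real) \<Rightarrow> ('a \<Rightarrow> 'a) \<Rightarrow> real" where
  "H1_norm p g = sqrt ((LINT x|lebesgue. (p x)\<^sup>2) + (LINT x|lebesgue. (norm (g x))\<^sup>2))"

text \<open>The dual of $H^1$: functionals whose values outside $H^1$ are irrelevant.  Boundedness
  forces them to respect equality almost everywhere.\<close>

definition H1_dual :: "(('a::euclidean_space \<Rightarrow> real) \<Rightarrow> real) \<Rightarrow> bool" where
  "H1_dual F \<longleftrightarrow>
     (\<forall>\<phi> g \<psi> h a b. H1 \<phi> g \<longrightarrow> H1 \<psi> h \<longrightarrow> F (\<lambda>x. a * \<phi> x + b * \<psi> x) = a * F \<phi> + b * F \<psi>) \<and>
     (\<exists>K. \<forall>\<phi> g. H1 \<phi> g \<longrightarrow> \<bar>F \<phi>\<bar> \<le> K * H1_norm \<phi> g)"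

definition H1_dual_norm :: "(('a::euclidean_space \<Rightarrow> real) \<Rightarrow> real) \<Rightarrow> real" where
  "H1_dual_norm F = Sup {\<bar>F \<phi>\<bar> | \<phi> g. H1 \<phi> g \<and> H1_norm \<phi> g \<le> 1}"

section \<open>Functions of time with values in function spaces\<close>

text \<open>
  $L^2(0,T;L^2)$ is identified with $L^2((0,T)\times\mathbb{R}^n)$, and membership in
  $L^2(0,T;H^1)$ means that the spatial weak gradient belongs to that space as well.
\<close>

definition L2_L2 :: "real \<Rightarrow> (real \<Rightarrow> 'a::euclidean_space \<Rightarrow> 'b::euclidean_space) \<Rightarrow> bool" where
  "L2_L2 T u \<longleftrightarrow> L2_fun (lebesgue_on ({0<..<T} \<times> UNIV)) (\<lambda>(t, x). u t x)"

definition L2_H1 ::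
  "real \<Rightarrow> (real \<Rightarrow> 'a::euclidean_space \<Rightarrow> real) \<Rightarrow> (real \<Rightarrow> 'a \<Rightarrow> 'a) \<Rightarrow> bool" where
  "L2_H1 T u Du \<longleftrightarrow> L2_L2 T u \<and> L2_L2 T Du \<and> (AE t in lebesgue_on {0<..<T}. H1 (u t) (Du t))"

text \<open>As $H^1$ is separable and reflexive, weak and strong measurability of a map into its dual
  coincide (Pettis).\<close>

definition L2_H1_dual :: "real \<Rightarrow> (real \<Rightarrow> ('a::euclidean_space \<Rightarrow> real) \<Rightarrow> real) \<Rightarrow> bool" where
  "L2_H1_dual T F \<longleftrightarrow>
     (AE t in lebesgue_on {0<..<T}. H1_dual (F t)) \<and>
     (\<forall>\<phi> g. H1 \<phi> g \<longrightarrow> (\<lambda>t. F t \<phi>) \<in> borel_measurable (lebesgue_on {0<..<T})) \<and>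
     integrable (lebesgue_on {0<..<T}) (\<lambda>t. (H1_dual_norm (F t))\<^sup>2)"

text \<open>Distributional derivatives in time, for functions valued in $L^2$ and, via the embedding
  $L^2 \subset (H^1)'$, in $(H^1)'$.\<close>

definition weak_time_deriv_L2 ::
  "real \<Rightarrow> (real \<Rightarrow> 'a::euclidean_space \<Rightarrow> real) \<Rightarrow> (real \<Rightarrow> 'a \<Rightarrow> real) \<Rightarrow> bool" where
  "weak_time_deriv_L2 T u u' \<longleftrightarrow> (\<forall>\<psi>. test_function {0<..<T} \<psi> \<longrightarrow>
     (AE x in lebesgue. (LINT t|lebesgue_on {0<..<T}. deriv \<psi> t * u t x)
                      = - (LINT t|lebesgue_on {0<..<T}. \<psi> t * u' t x)))"

definition weak_time_deriv_H1_dual ::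
  "real \<Rightarrow> (real \<Rightarrow> 'a::euclidean_space \<Rightarrow> real) \<Rightarrow> (real \<Rightarrow> ('a \<Rightarrow> real) \<Rightarrow> real) \<Rightarrow> bool" where
  "weak_time_deriv_H1_dual T u F \<longleftrightarrow> (\<forall>\<psi> \<phi> g. test_function {0<..<T} \<psi> \<longrightarrow> H1 \<phi> g \<longrightarrow>
     (LINT t|lebesgue_on {0<..<T}. deriv \<psi> t * (LINT x|lebesgue. u t x * \<phi> x))
       = - (LINT t|lebesgue_on {0<..<T}. \<psi> t * F t \<phi>))"

text \<open>Initial values in the usual sense: the function has a representative that is continuous on
  the closed interval \<open>[0, T]\<close> with values in $L^2$ (resp. $(H^1)'$) and takes the given value at
  time \<open>0\<close>.\<close>

definition initial_value_L2 ::
  "real \<Rightarrow> (real \<Rightarrow> 'a::euclidean_space \<Rightarrow> real) \<Rightarrow> ('a \<Rightarrow> real) \<Rightarrow> bool" where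
  "initial_value_L2 T u a \<longleftrightarrow> (\<exists>U.
     (\<forall>t\<in>{0..T}. L2_fun lebesgue (U t)) \<and>
     (\<forall>s\<in>{0..T}. ((\<lambda>t. L2_norm (\<lambda>x. U t x - U s x)) \<longlongrightarrow> 0) (at s within {0..T})) \<and>
     (AE t in lebesgue_on {0<..<T}. AE x in lebesgue. U t x = u t x) \<and>
     (AE x in lebesgue. U 0 x = a x))"

definition initial_value_H1_dual ::
  "real \<Rightarrow> (real \<Rightarrow> 'a::euclidean_space \<Rightarrow> real) \<Rightarrow> ('a \<Rightarrow> real) \<Rightarrow> bool" where
  "initial_value_H1_dual T u a \<longleftrightarrow> (\<exists>V.
     (\<forall>t\<in>{0..T}. H1_dual (V t)) \<and>
     (\<forall>s\<in>{0..T}. ((\<lambda>t. H1_dual_norm (\<lambda>\<phi>. V t \<phi> - V s \<phi>)) \<longlongrightarrow> 0) (at s within {0..T})) \<and>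
     (AE t in lebesgue_on {0<..<T}. \<forall>\<phi> g. H1 \<phi> g \<longrightarrow> V t \<phi> = (LINT x|lebesgue. u t x * \<phi> x)) \<and>
     (\<forall>\<phi> g. H1 \<phi> g \<longrightarrow> V 0 \<phi> = (LINT x|lebesgue. a x * \<phi> x)))"

section \<open>The two equations\<close>

text \<open>Weak solutions of $(\partial_t^2 - L_\sigma) u = 0$ in $(0,T)\times\mathbb{R}^3$,
  $u(0,\cdot) = 0$, $\partial_t u(0,\cdot) = f$.\<close>

definition weak_wave_solution ::
  "(real^3 \<Rightarrow> real^3^3) \<Rightarrow> real \<Rightarrow> (real^3 \<Rightarrow> real) \<Rightarrow> (real \<Rightarrow> real^3 \<Rightarrow> real) \<Rightarrow> bool" where
  "weak_wave_solution \<sigma> T f u \<longleftrightarrow> (\<exists>Du u' u''.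
     L2_H1 T u Du \<and>
     L2_L2 T u' \<and> weak_time_deriv_L2 T u u' \<and>
     L2_H1_dual T u'' \<and> weak_time_deriv_H1_dual T u' u'' \<and>
     (AE t in lebesgue_on {0<..<T}. \<forall>\<phi> g. H1 \<phi> g \<longrightarrow>
        u'' t \<phi> + (LINT x|lebesgue. (\<sigma> x *v Du t x) \<bullet> g x) = 0) \<and>
     initial_value_L2 T u (\<lambda>x. 0) \<and>
     initial_value_H1_dual T u' f)"

text \<open>Weak solutions in $H^1$ of $(L_\sigma - \tau^2) v + f = 0$ in $\mathbb{R}^3$.\<close>

definition weak_elliptic_solution ::
  "(real^3 \<Rightarrow> real^3^3) \<Rightarrow> real \<Rightarrow> (real^3 \<Rightarrow> real) \<Rightarrow> (real^3 \<Rightarrow> real) \<Rightarrow> bool" where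
  "weak_elliptic_solution \<sigma> \<tau> f v \<longleftrightarrow> (\<exists>Dv. H1 v Dv \<and>
     (\<forall>\<phi> g. H1 \<phi> g \<longrightarrow>
        - (LINT x|lebesgue. (\<sigma> x *v Dv x) \<bullet> g x) - \<tau>\<^sup>2 * (LINT x|lebesgue. v x * \<phi> x)
          + (LINT x|lebesgue. f x * \<phi> x) = 0))"

section \<open>The two settings\<close>

definition matrix_le :: "real^3^3 \<Rightarrow> real^3^3 \<Rightarrow> bool" where
  "matrix_le A B \<longleftrightarrow> (\<forall>\<xi>. \<xi> \<bullet> (A *v \<xi>) \<le> \<xi> \<bullet> (B *v \<xi>))"

definition upper_half :: "(real^3) set" where
  "upper_half = {x. x $ 3 > 0}"

definition lower_half :: "(real^3) set" where
  "lower_half = {x. x $ 3 < 0}"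

definition conductivity :: "(real^3 \<Rightarrow> real^3^3) \<Rightarrow> bool" where
  "conductivity \<gamma> \<longleftrightarrow>
     (AE x in lebesgue. transpose (\<gamma> x) = \<gamma> x) \<and>
     (\<forall>i j. (\<lambda>x. \<gamma> x $ i $ j) \<in> borel_measurable lebesgue \<and>
            (\<exists>K. AE x in lebesgue. \<bar>\<gamma> x $ i $ j\<bar> \<le> K)) \<and>
     (\<exists>c0>0. AE x in lebesgue. matrix_le (mat c0) (\<gamma> x))"

definition jump_condition :: "(real^3 \<Rightarrow> real^3^3) \<Rightarrow> real \<Rightarrow> (real^3) set \<Rightarrow> bool" where
  "jump_condition \<gamma> b D \<longleftrightarrow> (\<exists>c>0.
     (AE x in lebesgue. x \<in> D \<longrightarrow> matrix_le (mat c) (\<gamma> x - mat b)) \<or>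
     (AE x in lebesgue. x \<in> D \<longrightarrow> matrix_le (mat c) (mat b - \<gamma> x)))"

definition non_layered_setting ::
  "(real^3 \<Rightarrow> real^3^3) \<Rightarrow> (real^3 \<Rightarrow> real^3^3) \<Rightarrow> (real^3) set \<Rightarrow> (real^3) set \<Rightarrow> bool" where
  "non_layered_setting \<gamma>0 \<gamma> D B \<longleftrightarrow>
     (\<forall>x. \<gamma>0 x = mat 1) \<and>
     connected (- D) \<and>
     (AE x in lebesgue. x \<notin> D \<longrightarrow> \<gamma> x = mat 1) \<and>
     jump_condition \<gamma> 1 D \<and>
     open B \<and> closure B \<inter> closure D = {}"

definition two_layered_setting ::
  "(real^3 \<Rightarrow> real^3^3) \<Rightarrow> (real^3 \<Rightarrow> real^3^3) \<Rightarrow> (real^3) set \<Rightarrow> (real^3) set \<Rightarrow> bool" where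
  "two_layered_setting \<gamma>0 \<gamma> D B \<longleftrightarrow> (\<exists>gp gm :: real.
     gp > 0 \<and> gm > 0 \<and> gp \<noteq> gm \<and>
     (\<forall>x\<in>upper_half. \<gamma>0 x = mat gp) \<and> (\<forall>x\<in>lower_half. \<gamma>0 x = mat gm) \<and>
     closure D \<subseteq> lower_half \<and> connected (lower_half - D) \<and>
     (AE x in lebesgue. x \<in> upper_half \<longrightarrow> \<gamma> x = mat gp) \<and>
     (AE x in lebesgue. x \<in> lower_half - D \<longrightarrow> \<gamma> x = mat gm) \<and>
     jump_condition \<gamma> gm D \<and>
     open B \<and> closure B \<subseteq> upper_half)"

text \<open>The support of a function that is only determined up to null sets.\<close>

definition ess_support :: "('a::euclidean_space \<Rightarrow> real) \<Rightarrow> 'a set" where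
  "ess_support f = - \<Union>{U. open U \<and> (AE x in lebesgue. x \<in> U \<longrightarrow> f x = 0)}"

definition source :: "(real^3) set \<Rightarrow> (real^3 \<Rightarrow> real) \<Rightarrow> bool" where
  "source B f \<longleftrightarrow> L2_fun lebesgue f \<and> ess_support f \<subseteq> closure B \<and>
     (\<exists>c1>0. (AE x in lebesgue. x \<in> B \<longrightarrow> f x \<ge> c1) \<or> (AE x in lebesgue. x \<in> B \<longrightarrow> - f x \<ge> c1))"

section \<open>The indicator functions\<close>

definition laplace_trunc :: "real \<Rightarrow> (real \<Rightarrow> real^3 \<Rightarrow> real) \<Rightarrow> real \<Rightarrow> real^3 \<Rightarrow> real" where
  "laplace_trunc T u \<tau> x = (LINT t|lebesgue_on {0<..<T}. exp (- \<tau> * t) * u t x)"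

definition indicator_I ::
  "(real^3 \<Rightarrow> real) \<Rightarrow> real \<Rightarrow> (real \<Rightarrow> real^3 \<Rightarrow> real) \<Rightarrow> (real \<Rightarrow> real^3 \<Rightarrow> real) \<Rightarrow> real \<Rightarrow> real" where
  "indicator_I f T u v \<tau> = (LINT x|lebesgue. f x * (laplace_trunc T u \<tau> x - v \<tau> x))"

definition indicator_I_tilde ::
  "(real^3 \<Rightarrow> real) \<Rightarrow> real \<Rightarrow> (real \<Rightarrow> real^3 \<Rightarrow> real) \<Rightarrow> (real \<Rightarrow> real^3 \<Rightarrow> real) \<Rightarrow> real \<Rightarrow> real" where
  "indicator_I_tilde f T u u0 \<tau> =
     (LINT t|lebesgue_on {0<..<T}. LINT x|lebesgue. exp (- \<tau> * t) * f x * (u t x - u0 t x))"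

end

theory Submission
  imports Defs
begin

text \<open>
  The truncated Laplace transform \<open>v~\<close> of \<open>u\<^sub>0\<close> solves the same elliptic equation as \<open>v\<close>, up to the
  boundary terms at \<open>t = T\<close>: the difference \<open>z = v~ - v\<close> satisfies
  \<open>(L - \<tau>\<^sup>2) z = exp (- \<tau> T) (\<partial>\<^sub>t u\<^sub>0(T) + \<tau> u\<^sub>0(T))\<close> weakly.  Only \<open>u\<^sub>0(T) \<in> L\<^sup>2\<close> and
  \<open>\<partial>\<^sub>t u\<^sub>0(T) \<in> (H\<^sup>1)'\<close> are needed: testing with \<open>z\<close> bounds the energy of \<open>z\<close>, whose zeroth-order
  part is \<open>\<tau>\<^sup>2 \<parallel>z\<parallel>\<^sup>2\<close>, by a multiple of \<open>exp (- 2 \<tau> T)\<close>.  As \<open>\<gamma>\<close> enters both indicator functions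
  through the same term, their difference is \<open>\<integral> f (v - v~)\<close>, and Cauchy-Schwarz concludes.
\<close>

section \<open>Smooth cutoffs on the line\<close>

text \<open>The weak time derivatives are tested only with smooth functions compactly supported in
  the open interval, while the weight \<open>exp (- \<tau> * t)\<close> vanishes at neither end.
  Much of the work is therefore an integration by parts with boundary terms: the weight is
  multiplied by smooth cutoffs, whose derivatives form two bumps concentrating at 0 and at T and
  produce there the values of the continuous representatives that come with the initial conditions.
  For the time derivative this representative is continuous only in the dual of H^1, so its value at
  T has to be treated as a functional. For \<tau> \<ge> 1 this costs nothing: the gradient part of
  the functional is absorbed by ellipticity, the rest by the zeroth-order term. The values at T
  depend on f through \<open>u0\<close>, but not on \<tau>. The resulting bound has a single factor
  \<open>L2_norm f\<close> and a constant depending on \<open>u0\<close>; the second factor is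
  obtained by dividing this constant by \<open>L2_norm f\<close>, as the final constant has to be
  independent of \<tau> only.\<close>

lemma C_k_Suc_real:
  fixes \<phi> :: "real \<Rightarrow> real"
  shows "C_k (Suc k) \<phi> \<longleftrightarrow> (\<forall>x. \<phi> differentiable (at x)) \<and> C_k k (deriv \<phi>)"
proof -
  have "(\<lambda>x. frechet_derivative \<phi> (at x) 1) = deriv \<phi>" if "\<forall>x. \<phi> differentiable (at x)"
  proof
    fix x
    have "(\<phi> has_derivative (*) (deriv \<phi> x)) (at x)"
      using that by (simp add: DERIV_deriv_iff_real_differentiable flip: has_field_derivative_def)
    then show "frechet_derivative \<phi> (at x) 1 = deriv \<phi> x"
      by (simp flip: frechet_derivative_at)
  qed
  then show ?thesis
    by auto
qed

lemma C_k_SucI_real: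
  fixes \<phi> :: "real \<Rightarrow> real"
  assumes "\<And>x. (\<phi> has_real_derivative \<phi>' x) (at x)" and "C_k k \<phi>'"
  shows "C_k (Suc k) \<phi>"
proof -
  have "deriv \<phi> = \<phi>'"
    using assms(1) by (auto intro!: DERIV_imp_deriv)
  then show ?thesis
    using assms unfolding C_k_Suc_real by (auto simp: real_differentiable_def)
qed

lemma C_k_const: "C_k k (\<lambda>x::real. c)"
proof (induction k arbitrary: c)
  case (Suc k)
  show ?case
    by (rule C_k_SucI_real[OF _ Suc[of 0]]) (auto intro!: derivative_eq_intros)
qed simp

lemma C_k_add:
  fixes f g :: "real \<Rightarrow> real"
  shows "C_k k f \<Longrightarrow> C_k k g \<Longrightarrow> C_k k (\<lambda>x. f x + g x)"
proof (induction k arbitrary: f g)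
  case 0
  then show ?case by (auto intro: continuous_intros)
next
  case (Suc k)
  show ?case
  proof (rule C_k_SucI_real)
    show "((\<lambda>x. f x + g x) has_real_derivative (deriv f x + deriv g x)) (at x)" for x
      using Suc.prems unfolding C_k_Suc_real
      by (intro DERIV_add) (auto simp: DERIV_deriv_iff_real_differentiable)
    show "C_k k (\<lambda>x. deriv f x + deriv g x)"
      using Suc unfolding C_k_Suc_real by blast
  qed
qed

text \<open>The recursion asks for differentiability and for regularity of the derivative, so the
  inclusion of the classes is not built in. The product rule needs it, because it keeps one factor
  undifferentiated.\<close>

lemma C_k_SucD_real:
  fixes f :: "real \<Rightarrow> real"
  shows "C_k (Suc k) f \<Longrightarrow> C_k k f"
proof (induction k arbitrary: f)
  case 0
  then show ?case
    by (auto simp: C_k_Suc_real intro!: continuous_at_imp_continuous_on differentiable_imp_continuous_within)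
next
  case (Suc k)
  then show ?case
    using C_k_Suc_real by blast
qed

lemma C_k_mult:
  fixes f g :: "real \<Rightarrow> real"
  shows "C_k k f \<Longrightarrow> C_k k g \<Longrightarrow> C_k k (\<lambda>x. f x * g x)"
proof (induction k arbitrary: f g)
  case 0
  then show ?case by (auto intro: continuous_intros)
next
  case (Suc k)
  show ?case
  proof (rule C_k_SucI_real)
    show "((\<lambda>x. f x * g x) has_real_derivative (deriv f x * g x + deriv g x * f x)) (at x)" for x
      using Suc.prems unfolding C_k_Suc_real
      by (intro DERIV_mult) (auto simp: DERIV_deriv_iff_real_differentiable)
    have "C_k k (deriv f)" "C_k k (deriv g)" "C_k k f" "C_k k g"
      using Suc.prems C_k_SucD_real C_k_Suc_real by blast+
    then show "C_k k (\<lambda>x. deriv f x * g x + deriv g x * f x)"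
      by (intro C_k_add Suc.IH)
  qed
qed

lemma C_k_compose_affine:
  fixes f :: "real \<Rightarrow> real"
  shows "C_k k f \<Longrightarrow> C_k k (\<lambda>x. f (a * x + b))"
proof (induction k arbitrary: f)
  case 0
  then show ?case by (auto intro!: continuous_intros continuous_on_compose2[of UNIV f])
next
  case (Suc k)
  show ?case
  proof (rule C_k_SucI_real)
    show "((\<lambda>x. f (a * x + b)) has_real_derivative (a * deriv f (a * x + b))) (at x)" for x
    proof (rule DERIV_chain2[where f = f and g = "\<lambda>x. a * x + b", THEN DERIV_cong])
      show "(f has_real_derivative deriv f (a * x + b)) (at (a * x + b))"
        using Suc.prems unfolding C_k_Suc_real by (simp add: DERIV_deriv_iff_real_differentiable)
      show "((\<lambda>x. a * x + b) has_real_derivative a) (at x)"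
        by (auto intro!: derivative_eq_intros)
    qed simp
    show "C_k k (\<lambda>x. a * deriv f (a * x + b))"
      using Suc unfolding C_k_Suc_real by (intro C_k_mult C_k_const) blast
  qed
qed

lemma C_k_exp: "C_k k (\<lambda>t. exp (c * t) :: real)"
proof (induction k)
  case (Suc k)
  show ?case
    by (rule C_k_SucI_real[OF _ C_k_mult[OF C_k_const Suc]]) (auto intro!: derivative_eq_intros)
qed (auto intro!: continuous_intros)

text \<open>The classical smooth function that is flat at 0. It vanishes on the negative half line
  and tends to 1 at infinity, so its rescalings switch on near an end point while its nonnegative
  derivative keeps total mass 1.\<close>

definition flat_exp :: "real \<Rightarrow> real" where
  "flat_exp x = (if x > 0 then exp (- (1 / x)) else 0)"

definition flat_exp' :: "real \<Rightarrow> real" where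
  "flat_exp' x = (if x > 0 then exp (- (1 / x)) / x\<^sup>2 else 0)"

text \<open>Differentiating \<open>P (1/x) exp (-1/x)\<close> gives the polynomial \<open>X\<^sup>2 (P - P')\<close>, so the family
  is closed under differentiation.\<close>

lemma flat_poly_DERIV:
  fixes p :: "real poly"
  defines "F \<equiv> \<lambda>p x. if x > 0 then poly p (1 / x) * exp (- (1 / x)) else (0::real)"
  shows "(F p has_real_derivative F ([:0, 0, 1:] * (p - pderiv p)) x) (at x)"
proof -
  consider "x > 0" | "x < 0" | "x = 0" by linarith
  then show ?thesis
  proof cases
    case 1
    have "((\<lambda>x. poly p (1 / x) * exp (- (1 / x))) has_real_derivative
       F ([:0, 0, 1:] * (p - pderiv p)) x) (at x)"
      using 1 by (auto intro!: derivative_eq_intros DERIV_chain2[of "poly p"] poly_DERIV simp: F_def field_simps power2_eq_square)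
    then show ?thesis
      by (rule has_field_derivative_transform_within_open[where S = "{0<..}"]) (use 1 in \<open>auto simp: F_def\<close>)
  next
    case 2
    have "((\<lambda>x. 0) has_real_derivative F ([:0, 0, 1:] * (p - pderiv p)) x) (at x)"
      using 2 by (auto simp: F_def)
    then show ?thesis
      by (rule has_field_derivative_transform_within_open[where S = "{..<0}"]) (use 2 in \<open>auto simp: F_def\<close>)
  next
    case 3
    have lim: "((\<lambda>y. poly q y * exp (- y)) \<longlongrightarrow> 0) at_top" for q :: "real poly"
    proof -
      have "((\<lambda>y. \<Sum>i\<le>degree q. coeff q i * (y ^ i / exp y)) \<longlongrightarrow> (\<Sum>i\<le>degree q. coeff q i * 0)) at_top"
        by (intro tendsto_intros tendsto_power_div_exp_0)
      then show ?thesis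
        by (simp add: poly_altdef sum_distrib_right exp_minus divide_inverse mult.assoc)
    qed
    have "((\<lambda>h. (F p (0 + h) - F p 0) / h) \<longlongrightarrow> 0) (at_right 0)"
    proof -
      \<comment> \<open>\<open>pCons 0 p\<close> is the polynomial X P: the additional factor
        \<open>inverse h\<close> is the division by \<open>h\<close> in the difference quotient at
        0.\<close>
      have "((\<lambda>h. poly (pCons 0 p) (inverse h) * exp (- inverse h)) \<longlongrightarrow> 0) (at_right (0::real))"
        by (rule filterlim_compose[OF lim filterlim_inverse_at_top_right])
      then show ?thesis
        by (rule Lim_transform_eventually)
           (auto simp: eventually_at_filter F_def divide_inverse)
    qed
    moreover have "((\<lambda>h. (F p (0 + h) - F p 0) / h) \<longlongrightarrow> 0) (at_left 0)"
      by (rule Lim_transform_eventually[OF tendsto_const]) (auto simp: eventually_at_filter F_def)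
    ultimately have "((\<lambda>h. (F p (0 + h) - F p 0) / h) \<longlongrightarrow> 0) (at 0)"
      by (simp add: filterlim_split_at)
    moreover have "F ([:0, 0, 1:] * (p - pderiv p)) 0 = 0"
      by (simp add: F_def)
    ultimately show ?thesis
      using 3 unfolding DERIV_def by simp
  qed
qed

lemma flat_exp_DERIV: "(flat_exp has_real_derivative flat_exp' x) (at x)"
  using flat_poly_DERIV[of 1 x]
  by (simp add: flat_exp_def[abs_def] flat_exp'_def power2_eq_square divide_simps mult.commute cong: if_cong)

text \<open>Each differentiation changes the polynomial in front of the exponential, so the
  induction has to run over all polynomials at once; \<open>flat_exp\<close> is the case of the
  polynomial 1.\<close>

lemma C_k_flat_exp: "C_k k flat_exp"
proof -
  have "C_k k (\<lambda>x. if x > 0 then poly p (1 / x) * exp (- (1 / x)) else 0)" for p :: "real poly"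
  proof (induction k arbitrary: p)
    case 0
    show ?case
      using flat_poly_DERIV[of p] by (auto intro!: continuous_at_imp_continuous_on DERIV_isCont)
  next
    case (Suc k)
    show ?case
      by (rule C_k_SucI_real[OF flat_poly_DERIV Suc])
  qed
  from this[of 1] show ?thesis
    by (simp add: flat_exp_def[abs_def] cong: if_cong)
qed

lemma flat_exp_nonneg: "0 \<le> flat_exp x" and flat_exp_le_1: "flat_exp x \<le> 1"
  by (auto simp: flat_exp_def)

lemma flat_exp'_nonneg: "0 \<le> flat_exp' x"
  by (auto simp: flat_exp'_def)

lemma flat_exp_at_top: "(flat_exp \<longlongrightarrow> 1) at_top"
proof -
  have "((\<lambda>x::real. exp (- (inverse x))) \<longlongrightarrow> exp (- 0)) at_top"
    by (intro tendsto_intros tendsto_inverse_0_at_top filterlim_ident)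
  then have "((\<lambda>x::real. exp (- (inverse x))) \<longlongrightarrow> 1) at_top"
    by simp
  then show ?thesis
    by (rule Lim_transform_eventually)
       (auto intro!: eventually_mono[OF eventually_gt_at_top[of 0]] simp: flat_exp_def divide_inverse)
qed

lemma continuous_flat_exp: "continuous_on S flat_exp"
  using flat_exp_DERIV by (auto intro!: continuous_at_imp_continuous_on DERIV_isCont)

lemma flat_exp_borel [measurable]: "flat_exp \<in> borel_measurable borel"
  by (rule borel_measurable_continuous_onI[OF continuous_flat_exp])

lemma flat_exp'_borel [measurable]: "flat_exp' \<in> borel_measurable borel"
  unfolding flat_exp'_def[abs_def] by measurable

text \<open>The mass is the increase of \<open>flat_exp\<close> from its value 0 at -1 to its limit
  1. The shift by 1 is the one used in the cutoffs, where it keeps the supports away from the end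
  points.\<close>

lemma flat_exp'_integral: "has_bochner_integral lborel (\<lambda>s. flat_exp' (s - 1)) 1"
proof -
  have D: "((\<lambda>x. flat_exp (x - 1)) has_real_derivative flat_exp' (x - 1)) (at x)" for x
    by (rule DERIV_chain2[OF flat_exp_DERIV, THEN DERIV_cong]) (auto intro!: derivative_eq_intros)
  have L: "((\<lambda>x. flat_exp (x - 1)) \<longlongrightarrow> 1) at_top"
    by (rule filterlim_compose[OF flat_exp_at_top]) (auto intro!: filterlim_tendsto_add_at_top[of "\<lambda>_. - 1", simplified] filterlim_ident tendsto_const)
  have "(\<integral>\<^sup>+x. ennreal (flat_exp' (x - 1)) * indicator {0 ..} x \<partial>lborel) = 1 - flat_exp (0 - 1)"
    by (rule nn_integral_FTC_atLeast[OF _ D _ L]) (auto simp: flat_exp'_nonneg)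
  also have "(\<integral>\<^sup>+x. ennreal (flat_exp' (x - 1)) * indicator {0 ..} x \<partial>lborel)
      = (\<integral>\<^sup>+x. ennreal (flat_exp' (x - 1)) \<partial>lborel)"
    by (rule nn_integral_cong) (auto simp: flat_exp'_def indicator_def)
  finally show ?thesis
    by (intro has_bochner_integral_nn_integral) (auto simp: flat_exp_def flat_exp'_nonneg)
qed

section \<open>Integrals with respect to Lebesgue measure\<close>

lemma borel_measurable_lebesgue_on_cong_AE:
  fixes f g :: "'a::euclidean_space \<Rightarrow> 'b::euclidean_space"
  assumes S: "S \<in> sets lebesgue" and eq: "AE x in lebesgue_on S. f x = g x"
    and f: "f \<in> borel_measurable (lebesgue_on S)"
  shows "g \<in> borel_measurable (lebesgue_on S)"
proof -
  have "(\<lambda>x. indicator S x *\<^sub>R f x) \<in> borel_measurable lebesgue"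
    using S f by (simp add: borel_measurable_restrict_space_iff)
  moreover have "AE x in lebesgue. indicator S x *\<^sub>R f x = indicator S x *\<^sub>R g x"
    using eq S by (simp add: AE_restrict_space_iff) (auto elim!: eventually_mono simp: indicator_def)
  ultimately have "(\<lambda>x. indicator S x *\<^sub>R g x) \<in> borel_measurable lebesgue"
    by (rule borel_measurable_AE)
  then show ?thesis
    using S by (simp add: borel_measurable_restrict_space_iff)
qed

text \<open>No measurability is assumed: Lebesgue measure is complete, so two functions equal almost
  everywhere are both measurable or both not, and in the latter case both integrals have the default
  value 0.\<close>

lemma integral_lebesgue_on_cong_AE:
  fixes f g :: "'a::euclidean_space \<Rightarrow> 'b::euclidean_space"
  assumes S: "S \<in> sets lebesgue" and eq: "AE x in lebesgue_on S. f x = g x"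
  shows "integral\<^sup>L (lebesgue_on S) f = integral\<^sup>L (lebesgue_on S) g"
proof (cases "f \<in> borel_measurable (lebesgue_on S)")
  case True
  then show ?thesis
    using borel_measurable_lebesgue_on_cong_AE[OF assms True] eq by (intro integral_cong_AE)
next
  case False
  then have "g \<notin> borel_measurable (lebesgue_on S)"
    using borel_measurable_lebesgue_on_cong_AE[OF S, of g f] eq by (auto simp: eq_commute)
  with False show ?thesis
    using borel_measurable_integrable by (metis not_integrable_integral_eq)
qed

lemma integrable_lebesgue_on_cong_AE:
  fixes f g :: "'a::euclidean_space \<Rightarrow> 'b::euclidean_space"
  assumes S: "S \<in> sets lebesgue" and eq: "AE x in lebesgue_on S. f x = g x"
    and f: "integrable (lebesgue_on S) f"
  shows "integrable (lebesgue_on S) g"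
  using integrable_cong_AE_imp[OF f borel_measurable_lebesgue_on_cong_AE[OF S eq]] f eq by (auto simp: eq_commute)

lemmas integral_lebesgue_cong_AE = integral_lebesgue_on_cong_AE[where S = UNIV, simplified lebesgue_on_UNIV_eq, simplified]
  and integrable_lebesgue_cong_AE = integrable_lebesgue_on_cong_AE[where S = UNIV, simplified lebesgue_on_UNIV_eq, simplified]

lemma integral_lebesgue_on_eq_lborel:
  fixes h :: "'a::euclidean_space \<Rightarrow> 'b::euclidean_space"
  assumes "h \<in> borel_measurable borel" "S \<in> sets borel"
  shows "integral\<^sup>L (lebesgue_on S) h = (LINT x|lborel. indicator S x *\<^sub>R h x)"
  using assms by (simp add: integral_restrict_space integral_completion)

lemma integrable_mult_continuous_interval:
  fixes h :: "real \<Rightarrow> real"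
  assumes h: "continuous_on UNIV h" and l: "integrable (lebesgue_on {a<..<b}) l"
  shows "integrable (lebesgue_on {a<..<b}) (\<lambda>t. h t * l t)"
proof -
  have "bounded (h ` {a..b})"
    by (intro compact_imp_bounded compact_continuous_image continuous_on_subset[OF h]) auto
  then obtain B where B: "\<And>t. t \<in> {a..b} \<Longrightarrow> \<bar>h t\<bar> \<le> B"
    unfolding bounded_iff by (metis image_eqI real_norm_def)
  have [measurable]: "h \<in> borel_measurable (lebesgue_on {a<..<b})"
    by (intro measurable_restrict_space1 measurable_completion) (simp add: borel_measurable_continuous_onI[OF h])
  show ?thesis
  proof (rule Bochner_Integration.integrable_bound)
    show "integrable (lebesgue_on {a<..<b}) (\<lambda>t. B * l t)"
      using l by simp
    have "\<bar>h t * l t\<bar> \<le> \<bar>B * l t\<bar>" if "t \<in> {a<..<b}" for t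
      using B[of t] that by (auto simp: abs_mult intro!: mult_mono)
    then show "AE t in lebesgue_on {a<..<b}. norm (h t * l t) \<le> norm (B * l t)"
      by (intro AE_I2) auto
    show "(\<lambda>t. h t * l t) \<in> borel_measurable (lebesgue_on {a<..<b})"
      using l by measurable
  qed
qed

lemma integrable_continuous_interval:
  fixes h :: "real \<Rightarrow> real"
  assumes h: "continuous_on UNIV h"
  shows "integrable (lebesgue_on {a<..<b}) h"
proof -
  interpret finite_measure "lebesgue_on {a<..<b}"
    by (rule finite_measure_lebesgue_on) simp
  show ?thesis
    using integrable_mult_continuous_interval[OF h, of a b "\<lambda>_. 1"] by simp
qed

section \<open>Integration by parts for weak time derivatives\<close>

lemma continuous_flat_exp': "continuous_on S flat_exp'"
proof -
  have "deriv flat_exp = flat_exp'"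
    using flat_exp_DERIV by (auto intro!: DERIV_imp_deriv)
  then have "continuous_on UNIV flat_exp'"
    using C_k_flat_exp[of "Suc 0"] unfolding C_k_Suc_real by simp
  then show ?thesis
    by (rule continuous_on_subset) auto
qed

lemma flat_exp_scaled_tendsto_1:
  assumes "a > 0"
  shows "(\<lambda>n. flat_exp (real (Suc n) * a - b)) \<longlonglongrightarrow> 1"
proof (rule filterlim_compose[OF flat_exp_at_top])
  have "filterlim (\<lambda>n. a * real (Suc n)) at_top sequentially"
    by (rule filterlim_tendsto_pos_mult_at_top[OF tendsto_const assms])
       (rule filterlim_compose[OF filterlim_real_sequentially filterlim_Suc])
  then show "filterlim (\<lambda>n. real (Suc n) * a - b) at_top sequentially"
    using filterlim_tendsto_add_at_top[OF tendsto_const[of "-b"]] by (simp add: mult.commute)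
qed

text \<open>After rescaling, \<open>r exp'(r t - 1)\<close> is an approximate identity at the left end point.\<close>

lemma flat_exp'_approximate_identity:
  fixes m :: "real \<Rightarrow> real"
  assumes T: "0 < T" and m: "continuous_on UNIV m"
  shows "(\<lambda>n. LINT t|lebesgue_on {0<..<T}. real (Suc n) * flat_exp' (real (Suc n) * t - 1) *
             flat_exp (real (Suc n) * (T - t) - 1) * m t) \<longlonglongrightarrow> m 0"
proof -
  define J where "J = {0<..<T}"
  have [measurable]: "m \<in> borel_measurable borel"
    by (rule borel_measurable_continuous_onI[OF m])
  have "bounded (m ` {0..T})"
    by (intro compact_imp_bounded compact_continuous_image continuous_on_subset[OF m]) auto
  then obtain B where B: "\<And>t. t \<in> {0..T} \<Longrightarrow> \<bar>m t\<bar> \<le> B"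
    unfolding bounded_iff by (metis image_eqI real_norm_def)
  have B0: "B \<ge> 0"
    using B[of 0] T by auto
  \<comment> \<open>The substitution s = (n + 1) t absorbs the factor \<open>real (Suc n)\<close>.
    The profile \<open>flat_exp' (s - 1)\<close> is then independent of \<open>n\<close> and yields
    an integrable majorant, while the argument of \<open>m\<close> shrinks to 0. The indicator keeps
    the interval in the new variable.\<close>
  define g where "g n s = flat_exp' (s - 1) * flat_exp (real (Suc n) * T - s - 1) *
      (indicator J (s / real (Suc n)) * m (s / real (Suc n)))" for n s
  have eq: "(LINT t|lebesgue_on {0<..<T}. real (Suc n) * flat_exp' (real (Suc n) * t - 1) *
             flat_exp (real (Suc n) * (T - t) - 1) * m t) = (LINT s|lborel. g n s)" for n
  proof -
    let ?r = "real (Suc n)"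
    have "(LINT t|lebesgue_on {0<..<T}. ?r * flat_exp' (?r * t - 1) * flat_exp (?r * (T - t) - 1) * m t)
      = (LINT t|lborel. indicator J t *\<^sub>R (?r * flat_exp' (?r * t - 1) * flat_exp (?r * (T - t) - 1) * m t))"
      unfolding J_def by (rule integral_lebesgue_on_eq_lborel) auto
    also have "\<dots> = \<bar>1 / ?r\<bar> *\<^sub>R (LINT s|lborel. indicator J (0 + 1 / ?r * s) *\<^sub>R
        (?r * flat_exp' (?r * (0 + 1 / ?r * s) - 1) * flat_exp (?r * (T - (0 + 1 / ?r * s)) - 1) * m (0 + 1 / ?r * s)))"
      by (rule lborel_integral_real_affine) simp
    also have "\<dots> = (LINT s|lborel. \<bar>1 / ?r\<bar> *\<^sub>R (indicator J (0 + 1 / ?r * s) *\<^sub>R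
        (?r * flat_exp' (?r * (0 + 1 / ?r * s) - 1) * flat_exp (?r * (T - (0 + 1 / ?r * s)) - 1) * m (0 + 1 / ?r * s))))"
      by (rule Bochner_Integration.integral_scaleR_right[symmetric])
    also have "\<dots> = (LINT s|lborel. g n s)"
    proof (rule Bochner_Integration.integral_cong[OF refl])
      fix s
      have "?r * (0 + 1 / ?r * s) = s" "?r * (T - (0 + 1 / ?r * s)) = ?r * T - s" "0 + 1 / ?r * s = s / ?r"
        by (simp_all add: field_simps del: of_nat_Suc)
      then show "\<bar>1 / ?r\<bar> *\<^sub>R (indicator J (0 + 1 / ?r * s) *\<^sub>R
        (?r * flat_exp' (?r * (0 + 1 / ?r * s) - 1) * flat_exp (?r * (T - (0 + 1 / ?r * s)) - 1) * m (0 + 1 / ?r * s)))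
        = g n s"
        unfolding g_def by (simp del: of_nat_Suc)
    qed
    finally show ?thesis .
  qed
  have int: "integrable lborel (\<lambda>s. flat_exp' (s - 1))" "(LINT s|lborel. flat_exp' (s - 1)) = 1"
    using flat_exp'_integral by (auto simp: has_bochner_integral_iff)
  have [measurable]: "J \<in> sets borel"
    by (simp add: J_def)
  have "(\<lambda>n. LINT s|lborel. g n s) \<longlonglongrightarrow> (LINT s|lborel. flat_exp' (s - 1) * m 0)"
  proof (rule integral_dominated_convergence)
    show "integrable lborel (\<lambda>s. B * flat_exp' (s - 1))"
      using int by simp
    show "(\<lambda>s. flat_exp' (s - 1) * m 0) \<in> borel_measurable lborel"
      by measurable
    show "g n \<in> borel_measurable lborel" for n
      unfolding g_def by measurable
    have "norm (g n s) \<le> B * flat_exp' (s - 1)" for n s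
    proof -
      have "\<bar>indicator J (s / real (Suc n)) * m (s / real (Suc n))\<bar> \<le> B"
        using B[of "s / real (Suc n)"] B0 by (auto simp: indicator_def J_def simp del: of_nat_Suc)
      moreover have "\<bar>flat_exp' (s - 1) * flat_exp (real (Suc n) * T - s - 1)\<bar> \<le> flat_exp' (s - 1) * 1"
        using flat_exp_nonneg flat_exp_le_1 flat_exp'_nonneg
        by (simp add: abs_mult mult_left_le del: of_nat_Suc)
      ultimately have "\<bar>flat_exp' (s - 1) * flat_exp (real (Suc n) * T - s - 1)\<bar> *
          \<bar>indicator J (s / real (Suc n)) * m (s / real (Suc n))\<bar> \<le> flat_exp' (s - 1) * 1 * B"
        by (intro mult_mono) (auto simp: flat_exp'_nonneg)
      then show ?thesis
        by (simp add: g_def abs_mult mult.commute del: of_nat_Suc)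
    qed
    then show "AE s in lborel. norm (g n s) \<le> B * flat_exp' (s - 1)" for n
      by simp
    \<comment> \<open>For s \<le> 1 the profile vanishes. For s > 1 the point
      \<open>s / real (Suc n)\<close> is positive and eventually below T, so the indicator is
      eventually 1.\<close>
    have "(\<lambda>n. g n s) \<longlonglongrightarrow> flat_exp' (s - 1) * m 0" for s
    proof (cases "s > 1")
      case False
      then show ?thesis by (simp add: g_def flat_exp'_def)
    next
      case True
      have inv: "(\<lambda>n. s / real (Suc n)) \<longlonglongrightarrow> 0"
        by (rule LIMSEQ_Suc[OF lim_const_over_n])
      then have "\<forall>\<^sub>F n in sequentially. s / real (Suc n) < T"
        using T by (auto dest: order_tendstoD)
      then have ev: "\<forall>\<^sub>F n in sequentially. indicator J (s / real (Suc n)) = (1::real)"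
        by eventually_elim (use True in \<open>auto simp: J_def\<close>)
      have "(\<lambda>n. m (s / real (Suc n))) \<longlonglongrightarrow> m 0"
        using m inv by (auto intro!: isCont_tendsto_compose[of 0 m] simp: continuous_on_eq_continuous_at)
      moreover have "(\<lambda>n. indicator J (s / real (Suc n))) \<longlonglongrightarrow> (1::real)"
        by (rule tendsto_eventually[OF ev])
      moreover have "(\<lambda>n. flat_exp (real (Suc n) * T - s - 1)) \<longlonglongrightarrow> 1"
        using flat_exp_scaled_tendsto_1[OF T, of "s + 1"] by (simp add: algebra_simps)
      ultimately have "(\<lambda>n. g n s) \<longlonglongrightarrow> flat_exp' (s - 1) * 1 * (1 * m 0)"
        unfolding g_def by (intro tendsto_intros)
      then show ?thesis by simp
    qed
    then show "AE s in lborel. (\<lambda>n. g n s) \<longlonglongrightarrow> flat_exp' (s - 1) * m 0"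
      by simp
  qed
  then show ?thesis
    using eq int by simp
qed

text \<open>Reduces the bump at the right end point to the approximate identity at the left
  one.\<close>

lemma integral_interval_reflect:
  fixes h :: "real \<Rightarrow> real"
  assumes h[measurable]: "h \<in> borel_measurable borel"
  shows "(LINT t|lebesgue_on {0<..<T}. h (T - t)) = (LINT t|lebesgue_on {0<..<T}. h t)"
proof -
  have "(LINT t|lebesgue_on {0<..<T}. h t) = (LINT t|lborel. indicator {0<..<T} t *\<^sub>R h t)"
    by (rule integral_lebesgue_on_eq_lborel) auto
  also have "\<dots> = \<bar>- 1\<bar> *\<^sub>R (LINT t|lborel. indicator {0<..<T} (T + - 1 * t) *\<^sub>R h (T + - 1 * t))"
    by (rule lborel_integral_real_affine) simp
  also have "\<dots> = (LINT t|lborel. indicator {0<..<T} t *\<^sub>R h (T - t))"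
    by simp (intro Bochner_Integration.integral_cong, auto simp: indicator_def)
  also have "\<dots> = (LINT t|lebesgue_on {0<..<T}. h (T - t))"
    by (rule integral_lebesgue_on_eq_lborel[symmetric]) auto
  finally show ?thesis ..
qed

section \<open>Cutoffs in time and the boundary terms they produce\<close>

definition time_cutoff :: "real \<Rightarrow> nat \<Rightarrow> real \<Rightarrow> real" where
  "time_cutoff T n t = flat_exp (real (Suc n) * t - 1) * flat_exp (real (Suc n) * (T - t) - 1)"

definition time_cutoff' :: "real \<Rightarrow> nat \<Rightarrow> real \<Rightarrow> real" where
  "time_cutoff' T n t =
     real (Suc n) * flat_exp' (real (Suc n) * t - 1) * flat_exp (real (Suc n) * (T - t) - 1)
     - real (Suc n) * flat_exp (real (Suc n) * t - 1) * flat_exp' (real (Suc n) * (T - t) - 1)"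

lemma time_cutoff_DERIV: "(time_cutoff T n has_real_derivative time_cutoff' T n t) (at t)"
proof -
  define r where "r = real (Suc n)"
  have 1: "((\<lambda>t. flat_exp (r * t - 1)) has_real_derivative flat_exp' (r * t - 1) * r) (at t)"
    by (rule DERIV_chain2[where g = "\<lambda>t. r * t - 1", OF flat_exp_DERIV])
       (auto intro!: derivative_eq_intros)
  have 2: "((\<lambda>t. flat_exp (r * (T - t) - 1)) has_real_derivative flat_exp' (r * (T - t) - 1) * (- r)) (at t)"
    by (rule DERIV_chain2[where g = "\<lambda>t. r * (T - t) - 1", OF flat_exp_DERIV])
       (auto intro!: derivative_eq_intros)
  show ?thesis
    using DERIV_mult[OF 1 2] unfolding time_cutoff_def[abs_def] time_cutoff'_def r_def[symmetric]
    by (rule DERIV_cong) (simp add: algebra_simps)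
qed

lemma C_k_time_cutoff: "C_k k (time_cutoff T n)"
proof -
  define r where "r = real (Suc n)"
  have "C_k k (\<lambda>t. flat_exp (r * t + (- 1)) * flat_exp ((- r) * t + (r * T - 1)))"
    by (intro C_k_mult C_k_compose_affine C_k_flat_exp)
  also have "(\<lambda>t. flat_exp (r * t + (- 1)) * flat_exp ((- r) * t + (r * T - 1))) = time_cutoff T n"
    by (auto simp: time_cutoff_def fun_eq_iff r_def[symmetric] algebra_simps simp del: of_nat_Suc)
  finally show ?thesis .
qed

lemma test_function_time_cutoff:
  assumes "\<And>k. C_k k E"
  shows "test_function {0<..<T} (\<lambda>t. E t * time_cutoff T n t)"
proof -
  define r where "r = real (Suc n)"
  have r: "r > 0" by (simp add: r_def)
  \<comment> \<open>Here the shift by 1 in the definition pays off. For small \<open>n\<close> the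
    interval may be empty; the cutoff is then identically 0, which is still a test function.\<close>
  have "1 / r \<le> t" "t \<le> T - 1 / r" if "time_cutoff T n t \<noteq> 0" for t
    using that r by (auto simp: time_cutoff_def flat_exp_def r_def[symmetric] field_simps simp del: of_nat_Suc split: if_splits)
  then have sub: "closure {t. E t * time_cutoff T n t \<noteq> 0} \<subseteq> {1 / r .. T - 1 / r}"
    by (intro closure_minimal) auto
  then have "compact (closure {t. E t * time_cutoff T n t \<noteq> 0})"
    by (meson bounded_closed_interval bounded_subset closed_closure compact_eq_bounded_closed)
  moreover have "{1 / r .. T - 1 / r} \<subseteq> {0<..<T}"
  proof -
    have "1 / r > 0" using r by simp
    then show ?thesis
      by (intro subsetI) (simp only: atLeastAtMost_iff greaterThanLessThan_iff, linarith)
  qed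
  ultimately show ?thesis
    using sub assms unfolding test_function_def by (auto intro!: C_k_mult C_k_time_cutoff)
qed

lemma time_cutoff_bound: "\<bar>time_cutoff T n t\<bar> \<le> 1"
  using flat_exp_nonneg flat_exp_le_1 by (auto simp: time_cutoff_def abs_mult intro!: mult_le_one)

lemma time_cutoff_tendsto:
  assumes "t \<in> {0<..<T}"
  shows "(\<lambda>n. time_cutoff T n t) \<longlonglongrightarrow> 1"
proof -
  have "(\<lambda>n. time_cutoff T n t) \<longlonglongrightarrow> 1 * 1"
    unfolding time_cutoff_def using assms by (intro tendsto_mult flat_exp_scaled_tendsto_1) auto
  then show ?thesis by simp
qed

lemma continuous_time_cutoff: "continuous_on UNIV (time_cutoff T n)"
  using C_k_time_cutoff[of 0] by simp

lemma time_cutoff_integral_tendsto: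
  assumes l: "integrable (lebesgue_on {0<..<T}) l"
  shows "(\<lambda>n. LINT t|lebesgue_on {0<..<T}. time_cutoff T n t * l t) \<longlonglongrightarrow> (LINT t|lebesgue_on {0<..<T}. l t)"
proof (rule integral_dominated_convergence)
  show "integrable (lebesgue_on {0<..<T}) (\<lambda>t. \<bar>l t\<bar>)"
    using l by simp
  show "l \<in> borel_measurable (lebesgue_on {0<..<T})"
    using l by simp
  show "(\<lambda>t. time_cutoff T n t * l t) \<in> borel_measurable (lebesgue_on {0<..<T})" for n
    using integrable_mult_continuous_interval[OF continuous_time_cutoff l] by simp
  show "AE t in lebesgue_on {0<..<T}. norm (time_cutoff T n t * l t) \<le> \<bar>l t\<bar>" for n
    using time_cutoff_bound by (auto simp: abs_mult intro!: mult_left_le_one_le)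
  have "(\<lambda>n. time_cutoff T n t * l t) \<longlonglongrightarrow> l t" if "t \<in> {0<..<T}" for t
    using tendsto_mult[OF time_cutoff_tendsto[OF that] tendsto_const[of "l t"]] by simp
  then show "AE t in lebesgue_on {0<..<T}. (\<lambda>n. time_cutoff T n t * l t) \<longlonglongrightarrow> l t"
    by (intro AE_I2) auto
qed

text \<open>The derivative of the cutoff is an approximate unit mass at 0 minus its mirror image at
  T. Its limit against a continuous function is the source of both boundary terms.\<close>

lemma time_cutoff'_integral_tendsto:
  assumes T: "0 < T" and m: "continuous_on UNIV m"
  shows "(\<lambda>n. LINT t|lebesgue_on {0<..<T}. time_cutoff' T n t * m t) \<longlonglongrightarrow> m 0 - m T"
proof -
  define A where "A m n t = real (Suc n) * flat_exp' (real (Suc n) * t - 1) *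
      flat_exp (real (Suc n) * (T - t) - 1) * m t" for m :: "real \<Rightarrow> real" and n t
  have cont: "continuous_on UNIV (A m n)" if "continuous_on UNIV m" for m n
    unfolding A_def using that
    by (intro continuous_intros continuous_on_compose2[OF continuous_flat_exp[of UNIV]]
          continuous_on_compose2[OF continuous_flat_exp'[of UNIV]]) auto
  have m': "continuous_on UNIV (\<lambda>t. m (T - t))"
    by (rule continuous_on_compose2[OF m]) (auto intro!: continuous_intros)
  have "(LINT t|lebesgue_on {0<..<T}. time_cutoff' T n t * m t)
      = (LINT t|lebesgue_on {0<..<T}. A m n t) - (LINT t|lebesgue_on {0<..<T}. A (\<lambda>t. m (T - t)) n t)" for n
  proof -
    have "(LINT t|lebesgue_on {0<..<T}. time_cutoff' T n t * m t)
      = (LINT t|lebesgue_on {0<..<T}. A m n t - A (\<lambda>t. m (T - t)) n (T - t))"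
      \<comment> \<open>The second bump is the first one with \<open>m\<close> reflected, evaluated
        at \<open>T - t\<close>.\<close>
      by (intro Bochner_Integration.integral_cong) (auto simp: A_def time_cutoff'_def algebra_simps)
    also have "\<dots> = (LINT t|lebesgue_on {0<..<T}. A m n t) - (LINT t|lebesgue_on {0<..<T}. A (\<lambda>t. m (T - t)) n (T - t))"
      by (intro Bochner_Integration.integral_diff integrable_continuous_interval cont m
          continuous_on_compose2[OF cont[OF m']] continuous_intros) auto
    also have "(LINT t|lebesgue_on {0<..<T}. A (\<lambda>t. m (T - t)) n (T - t)) = (LINT t|lebesgue_on {0<..<T}. A (\<lambda>t. m (T - t)) n t)"
      by (intro integral_interval_reflect borel_measurable_continuous_onI cont m')
    finally show ?thesis .
  qed
  moreover have "(\<lambda>n. LINT t|lebesgue_on {0<..<T}. A m n t) \<longlonglongrightarrow> m 0"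
    unfolding A_def by (rule flat_exp'_approximate_identity[OF T m])
  moreover have "(\<lambda>n. LINT t|lebesgue_on {0<..<T}. A (\<lambda>t. m (T - t)) n t) \<longlonglongrightarrow> m T"
    using flat_exp'_approximate_identity[OF T m'] unfolding A_def by simp
  ultimately show ?thesis
    by (simp add: tendsto_diff)
qed

text \<open>\<open>E\<close> need not vanish at the end points, so \<open>E\<close> times a cutoff
  is tested and the cutoff is removed in the limit. As \<open>k\<close> matters only up to null
  sets, the boundary values are read off its continuous representative \<open>K\<close>.\<close>

lemma weak_derivative_integration_by_parts:
  fixes E K k l :: "real \<Rightarrow> real"
  assumes T: "0 < T" and K: "continuous_on {0..T} K"
    and Kk: "AE t in lebesgue_on {0<..<T}. K t = k t"
    and l: "integrable (lebesgue_on {0<..<T}) l"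
    and E: "\<And>j. C_k j E"
    and weak: "\<And>\<psi>. test_function {0<..<T} \<psi> \<Longrightarrow>
      (LINT t|lebesgue_on {0<..<T}. deriv \<psi> t * k t) = - (LINT t|lebesgue_on {0<..<T}. \<psi> t * l t)"
  shows "(LINT t|lebesgue_on {0<..<T}. E t * l t)
       = E T * K T - E 0 * K 0 - (LINT t|lebesgue_on {0<..<T}. deriv E t * k t)"
proof -
  let ?M = "lebesgue_on {0<..<T}"
  \<comment> \<open>Constant extension beyond the closed interval, since the limits for the cutoffs
    are stated for functions continuous on the whole line.\<close>
  define L where "L t = K (max 0 (min T t))" for t
  have L: "continuous_on UNIV L"
    unfolding L_def using T by (intro continuous_on_compose2[OF K] continuous_intros) auto
  have LK: "L t = K t" if "t \<in> {0..T}" for t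
    using that by (simp add: L_def)
  have Lk: "AE t in ?M. k t = L t"
    using Kk AE_space[of ?M] by eventually_elim (auto simp: LK)
  have contE: "continuous_on UNIV E" "continuous_on UNIV (deriv E)"
    using E[of 0] E[of "Suc 0"] unfolding C_k_Suc_real by simp_all
  have contC: "continuous_on UNIV (time_cutoff' T n)" for n
    unfolding time_cutoff'_def
    by (intro continuous_intros continuous_on_compose2[OF continuous_flat_exp[of UNIV]]
          continuous_on_compose2[OF continuous_flat_exp'[of UNIV]]) auto
  \<comment> \<open>The product rule separates a term where the cutoff just tends to 1 from one
    where its derivative concentrates at the end points.\<close>
  have split: "(LINT t|?M. time_cutoff T n t * (deriv E t * L t)) + (LINT t|?M. time_cutoff' T n t * (E t * L t))
      = - (LINT t|?M. time_cutoff T n t * (E t * l t))" for n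
  proof -
    define \<psi> where "\<psi> t = E t * time_cutoff T n t" for t
    have \<psi>': "deriv \<psi> t = deriv E t * time_cutoff T n t + time_cutoff' T n t * E t" for t
    proof -
      have "(E has_real_derivative deriv E t) (at t)"
        using E[of "Suc 0"] unfolding C_k_Suc_real by (simp add: DERIV_deriv_iff_real_differentiable)
      from DERIV_mult[OF this time_cutoff_DERIV] show ?thesis
        unfolding \<psi>_def by (rule DERIV_imp_deriv)
    qed
    have "(LINT t|?M. deriv \<psi> t * k t) = (LINT t|?M. deriv \<psi> t * L t)"
      using Lk by (intro integral_lebesgue_on_cong_AE) (auto elim: eventually_mono)
    also have "\<dots> = (LINT t|?M. time_cutoff T n t * (deriv E t * L t) + time_cutoff' T n t * (E t * L t))"
      by (simp add: \<psi>' algebra_simps)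
    also have "\<dots> = (LINT t|?M. time_cutoff T n t * (deriv E t * L t)) + (LINT t|?M. time_cutoff' T n t * (E t * L t))"
      by (intro Bochner_Integration.integral_add integrable_continuous_interval continuous_intros
          continuous_time_cutoff contE contC L)
    finally show ?thesis
      using weak[of \<psi>] test_function_time_cutoff[OF E, of T n] by (simp add: \<psi>_def[abs_def] ac_simps)
  qed
  have "(\<lambda>n. (LINT t|?M. time_cutoff T n t * (deriv E t * L t)) + (LINT t|?M. time_cutoff' T n t * (E t * L t)))
      \<longlonglongrightarrow> (LINT t|?M. deriv E t * L t) + (E 0 * L 0 - E T * L T)"
    by (intro tendsto_add time_cutoff_integral_tendsto time_cutoff'_integral_tendsto
        integrable_continuous_interval continuous_intros contE L T)
  moreover have "(\<lambda>n. - (LINT t|?M. time_cutoff T n t * (E t * l t))) \<longlonglongrightarrow> - (LINT t|?M. E t * l t)"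
    by (intro tendsto_minus time_cutoff_integral_tendsto integrable_mult_continuous_interval contE l)
  ultimately have "(LINT t|?M. deriv E t * L t) + (E 0 * L 0 - E T * L T) = - (LINT t|?M. E t * l t)"
    unfolding split by (rule LIMSEQ_unique)
  moreover have "(LINT t|?M. deriv E t * L t) = (LINT t|?M. deriv E t * k t)"
    using Lk by (intro integral_lebesgue_on_cong_AE) (auto elim: eventually_mono)
  ultimately show ?thesis
    using T by (simp add: LK)
qed

section \<open>Time integrals of square integrable functions of time and space\<close>

text \<open>Fubini is applied to products of Borel measures, whereas square integrability is stated
  with Lebesgue measurability; a Borel version bridges the two. It is assembled from the
  coordinates, for which the real-valued result applies.\<close>

lemma lebesgue_borel_representative:
  fixes f :: "'a::euclidean_space \<Rightarrow> 'b::euclidean_space"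
  assumes f: "f \<in> borel_measurable lebesgue"
  obtains g where "g \<in> borel_measurable borel" "AE x in lborel. f x = g x"
proof -
  have "\<forall>b\<in>Basis. \<exists>g. g \<in> borel_measurable lborel \<and> (AE x in lborel. f x \<bullet> b = g x)"
  proof
    fix b :: 'b
    have "(\<lambda>x. f x \<bullet> b) \<in> borel_measurable lebesgue"
      using f by simp
    from completion_ex_borel_measurable_real[OF this]
    show "\<exists>g. g \<in> borel_measurable lborel \<and> (AE x in lborel. f x \<bullet> b = g x)"
      by blast
  qed
  then obtain G where G: "\<And>b. b \<in> Basis \<Longrightarrow> G b \<in> borel_measurable lborel"
    "\<And>b. b \<in> Basis \<Longrightarrow> AE x in lborel. f x \<bullet> b = G b x"
    by metis
  show thesis
  proof
    have [measurable]: "\<And>b. b \<in> Basis \<Longrightarrow> G b \<in> borel_measurable borel"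
      using G(1) by simp
    show "(\<lambda>x. \<Sum>b\<in>Basis. G b x *\<^sub>R b) \<in> borel_measurable borel"
      by (intro borel_measurable_sum) simp
    have "AE x in lborel. \<forall>b\<in>Basis. f x \<bullet> b = G b x"
      using G(2) by (intro AE_finite_allI) auto
    then show "AE x in lborel. f x = (\<Sum>b\<in>Basis. G b x *\<^sub>R b)"
    proof eventually_elim
      case (elim x)
      then have "(\<Sum>b\<in>Basis. G b x *\<^sub>R b) = (\<Sum>b\<in>Basis. (f x \<bullet> b) *\<^sub>R b)"
        by (intro sum.cong) auto
      then show ?case by (simp add: euclidean_representation)
    qed
  qed
qed

lemma AE_lborel_prodD:
  fixes P :: "'a::euclidean_space \<times> 'b::euclidean_space \<Rightarrow> bool"
  assumes "AE p in lborel. P p"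
  shows "AE x in lebesgue. AE y in lebesgue. P (x, y)" "AE y in lebesgue. AE x in lebesgue. P (x, y)"
proof -
  have P: "AE p in lborel \<Otimes>\<^sub>M lborel. P p"
    using assms by (subst lborel_prod)
  show "AE x in lebesgue. AE y in lebesgue. P (x, y)"
    using lborel_pair.AE_pair[OF P] by (simp add: AE_completion_iff)
  have "AE p in distr (lborel \<Otimes>\<^sub>M lborel) (lborel \<Otimes>\<^sub>M lborel) (\<lambda>(y, x). (x, y)). P p"
    using P by (subst lborel_pair.distr_pair_swap[symmetric])
  then have "AE q in lborel \<Otimes>\<^sub>M lborel. P (case q of (y, x) \<Rightarrow> (x, y))"
    by (rule AE_distrD[rotated]) simp
  from lborel_pair.AE_pair[OF this] show "AE y in lebesgue. AE x in lebesgue. P (x, y)"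
    by (simp add: AE_completion_iff)
qed

text \<open>Extension by zero turns time integrals over the interval into integrals over the line,
  where Fubini for \<open>lborel\<close> is available. Both orders of the almost-everywhere equality
  are recorded: fixed times serve spatial slices and pairings, fixed points serve time
  integrals.\<close>

lemma L2_L2_representative:
  fixes w :: "real \<Rightarrow> 'a::euclidean_space \<Rightarrow> 'b::euclidean_space"
  assumes w: "L2_L2 T w"
  obtains W where "W \<in> borel_measurable (borel \<Otimes>\<^sub>M borel)" "\<And>t x. t \<notin> {0<..<T} \<Longrightarrow> W (t, x) = 0"
    "integrable (lborel \<Otimes>\<^sub>M lborel) (\<lambda>p. (norm (W p))\<^sup>2)"
    "AE t in lebesgue_on {0<..<T}. AE x in lebesgue. w t x = W (t, x)"
    "AE x in lebesgue. AE t in lebesgue_on {0<..<T}. w t x = W (t, x)"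
proof -
  define S :: "(real \<times> 'a) set" where "S = {0<..<T} \<times> UNIV"
  have Sb[measurable]: "S \<in> sets borel"
    unfolding S_def by (intro borel_open open_Times) auto
  then have S: "S \<in> sets lebesgue"
    by simp
  have w': "(\<lambda>(t, x). w t x) \<in> borel_measurable (lebesgue_on S)"
    "integrable (lebesgue_on S) (\<lambda>p. (norm (case p of (t, x) \<Rightarrow> w t x))\<^sup>2)"
    using w by (auto simp: L2_L2_def L2_fun_def S_def)
  have "(\<lambda>p. indicator S p *\<^sub>R (case p of (t, x) \<Rightarrow> w t x)) \<in> borel_measurable lebesgue"
    using w' S by (simp add: borel_measurable_restrict_space_iff)
  then obtain g where g[measurable]: "g \<in> borel_measurable borel"
    and ae: "AE p in lborel. indicator S p *\<^sub>R (case p of (t, x) \<Rightarrow> w t x) = g p"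
    by (rule lebesgue_borel_representative)
  define W where "W p = indicator S p *\<^sub>R g p" for p
  have [measurable]: "W \<in> borel_measurable borel"
    unfolding W_def by measurable
  have ae': "AE p in lborel. p \<in> S \<longrightarrow> (case p of (t, x) \<Rightarrow> w t x) = W p"
    using ae by eventually_elim (auto simp: W_def)
  show thesis
  proof
    show "W (t, x) = 0" if "t \<notin> {0<..<T}" for t x
      using that by (simp add: W_def S_def indicator_def)
    have "integrable lebesgue (\<lambda>p. indicator S p *\<^sub>R (norm (case p of (t, x) \<Rightarrow> w t x))\<^sup>2)"
      using w'(2) S by (simp add: integrable_restrict_space)
    then have "integrable lebesgue (\<lambda>p. (norm (W p))\<^sup>2)"
    proof (rule integrable_lebesgue_cong_AE[rotated])
      show "AE p in lebesgue. indicator S p *\<^sub>R (norm (case p of (t, x) \<Rightarrow> w t x))\<^sup>2 = (norm (W p))\<^sup>2"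
        unfolding AE_completion_iff using ae' by eventually_elim (auto simp: W_def indicator_def)
    qed
    then show "integrable (lborel \<Otimes>\<^sub>M lborel) (\<lambda>p. (norm (W p))\<^sup>2)"
      by (subst lborel_prod) (simp add: integrable_completion)
    show "W \<in> borel_measurable (borel \<Otimes>\<^sub>M borel)"
      by (simp add: borel_prod)
    show "AE t in lebesgue_on {0<..<T}. AE x in lebesgue. w t x = W (t, x)"
      using AE_lborel_prodD(1)[OF ae'] by (subst AE_restrict_space_iff) (auto simp: S_def elim: eventually_mono)
    show "AE x in lebesgue. AE t in lebesgue_on {0<..<T}. w t x = W (t, x)"
      using AE_lborel_prodD(2)[OF ae'] by (subst AE_restrict_space_iff) (auto simp: S_def elim: eventually_mono)
  qed
qed

text \<open>Cauchy-Schwarz against the constant 1: with m the total mass and a the integral of f,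
  the integral of (m f - a)^2 is nonnegative. Dividing by m leaves the case of zero mass
  apart.\<close>

lemma (in finite_measure) square_integral_le:
  fixes f :: "'a \<Rightarrow> real"
  assumes f: "integrable M f" and f2: "integrable M (\<lambda>x. (f x)\<^sup>2)"
  shows "(LINT x|M. f x)\<^sup>2 \<le> measure M (space M) * (LINT x|M. (f x)\<^sup>2)"
proof -
  let ?m = "measure M (space M)" and ?a = "LINT x|M. f x"
  have "0 \<le> (LINT x|M. (?m * f x - ?a)\<^sup>2)"
    by simp
  also have "\<dots> = (LINT x|M. ?m\<^sup>2 * (f x)\<^sup>2 - 2 * ?m * ?a * f x + ?a\<^sup>2)"
    by (simp add: power2_eq_square algebra_simps)
  also have "\<dots> = ?m\<^sup>2 * (LINT x|M. (f x)\<^sup>2) - 2 * ?m * ?a * ?a + ?m * ?a\<^sup>2"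
    using f f2 by simp
  also have "\<dots> = ?m * (?m * (LINT x|M. (f x)\<^sup>2) - ?a\<^sup>2)"
    by (simp add: power2_eq_square algebra_simps)
  finally have *: "0 \<le> ?m * (?m * (LINT x|M. (f x)\<^sup>2) - ?a\<^sup>2)" .
  show ?thesis
  proof (cases "?m = 0")
    case True
    then have "emeasure M (space M) = 0"
      by (simp add: emeasure_eq_measure)
    then have "?a = 0"
      by (intro integral_eq_zero_AE AE_I[of _ _ "space M"]) auto
    then show ?thesis using True by simp
  next
    case False
    then have "?m > 0" by (simp add: less_le)
    with * show ?thesis by (simp add: zero_le_mult_iff)
  qed
qed

lemma bounded_on_interval:
  fixes E :: "real \<Rightarrow> real"
  assumes "continuous_on UNIV E"
  obtains B where "B \<ge> 0" "\<And>t. t \<in> {0<..<T} \<Longrightarrow> \<bar>E t\<bar> \<le> B"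
proof -
  have "bounded (E ` {0..T})"
    by (intro compact_imp_bounded compact_continuous_image continuous_on_subset[OF assms]) auto
  then obtain B where B: "\<And>t. t \<in> {0..T} \<Longrightarrow> \<bar>E t\<bar> \<le> B"
    unfolding bounded_iff by (metis image_eqI real_norm_def)
  show thesis
  proof
    show "max 0 B \<ge> 0" by simp
    show "\<bar>E t\<bar> \<le> max 0 B" if "t \<in> {0<..<T}" for t
      using B[of t] that by auto
  qed
qed

lemma L2_L2_slice:
  fixes w :: "real \<Rightarrow> 'a::euclidean_space \<Rightarrow> 'b::euclidean_space"
  assumes "L2_L2 T w"
  shows "AE t in lebesgue_on {0<..<T}. L2_fun lebesgue (w t)"
proof -
  obtain W where W[measurable]: "W \<in> borel_measurable (borel \<Otimes>\<^sub>M borel)"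
    and W2: "integrable (lborel \<Otimes>\<^sub>M lborel) (\<lambda>p. (norm (W p))\<^sup>2)"
    and wW: "AE t in lebesgue_on {0<..<T}. AE x in lebesgue. w t x = W (t, x)"
    using assms by (rule L2_L2_representative)
  have "AE t in lebesgue. integrable lborel (\<lambda>x. (norm (W (t, x)))\<^sup>2)"
    using lborel_pair.AE_integrable_fst'[OF W2] by (simp add: AE_completion_iff)
  then have "AE t in lebesgue_on {0<..<T}. integrable lborel (\<lambda>x. (norm (W (t, x)))\<^sup>2)"
    by (subst AE_restrict_space_iff) (auto elim: eventually_mono)
  with wW show ?thesis
  proof eventually_elim
    case (elim t)
    have b: "(\<lambda>x. W (t, x)) \<in> borel_measurable borel"
      by measurable
    have "w t \<in> borel_measurable lebesgue"
      by (rule borel_measurable_AE[of "\<lambda>x. W (t, x)"])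
         (use elim b in \<open>auto intro!: measurable_completion elim: eventually_mono\<close>)
    moreover have "integrable lebesgue (\<lambda>x. (norm (w t x))\<^sup>2)"
      by (rule integrable_lebesgue_cong_AE[of "\<lambda>x. (norm (W (t, x)))\<^sup>2"])
         (use elim b in \<open>auto simp: integrable_completion elim: eventually_mono\<close>)
    ultimately show ?case by (simp add: L2_fun_def)
  qed
qed

lemma L2_L2_time_integral_representative:
  fixes w :: "real \<Rightarrow> 'a::euclidean_space \<Rightarrow> 'b::euclidean_space"
  assumes W[measurable]: "W \<in> borel_measurable (borel \<Otimes>\<^sub>M borel)"
    and W0: "\<And>t x. t \<notin> {0<..<T} \<Longrightarrow> W (t, x) = 0"
    and wW: "AE x in lebesgue. AE t in lebesgue_on {0<..<T}. w t x = W (t, x)"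
    and E: "continuous_on UNIV E"
  shows "AE x in lebesgue. (LINT t|lebesgue_on {0<..<T}. E t *\<^sub>R w t x) = (LINT t|lborel. E t *\<^sub>R W (t, x))"
  using wW
proof eventually_elim
  case (elim x)
  have [measurable]: "E \<in> borel_measurable borel"
    by (rule borel_measurable_continuous_onI[OF E])
  have "(LINT t|lebesgue_on {0<..<T}. E t *\<^sub>R w t x) = (LINT t|lebesgue_on {0<..<T}. E t *\<^sub>R W (t, x))"
    using elim by (intro integral_lebesgue_on_cong_AE) (auto elim: eventually_mono)
  also have "\<dots> = (LINT t|lborel. indicator {0<..<T} t *\<^sub>R (E t *\<^sub>R W (t, x)))"
    by (rule integral_lebesgue_on_eq_lborel) auto
  also have "\<dots> = (LINT t|lborel. E t *\<^sub>R W (t, x))"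
    using W0 by (intro Bochner_Integration.integral_cong) (auto simp: indicator_def)
  finally show ?case .
qed

text \<open>Cauchy-Schwarz in time on an interval of finite length bounds the square of the time
  integral at x by a multiple of the time integral of \<open>(norm (W (t, x)))\<^sup>2\<close>,
  which is integrable in x by Fubini.\<close>

lemma L2_L2_time_integral:
  fixes w :: "real \<Rightarrow> 'a::euclidean_space \<Rightarrow> 'b::euclidean_space"
  assumes w: "L2_L2 T w" and E: "continuous_on UNIV E"
  shows "L2_fun lebesgue (\<lambda>x. LINT t|lebesgue_on {0<..<T}. E t *\<^sub>R w t x)"
proof -
  obtain W where W[measurable]: "W \<in> borel_measurable (borel \<Otimes>\<^sub>M borel)"
    and W0: "\<And>t x. t \<notin> {0<..<T} \<Longrightarrow> W (t, x) = 0"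
    and W2: "integrable (lborel \<Otimes>\<^sub>M lborel) (\<lambda>p. (norm (W p))\<^sup>2)"
    and wW: "AE x in lebesgue. AE t in lebesgue_on {0<..<T}. w t x = W (t, x)"
    by (rule L2_L2_representative[OF w]) blast
  have [measurable]: "E \<in> borel_measurable borel"
    by (rule borel_measurable_continuous_onI[OF E])
  obtain B where B: "B \<ge> 0" "\<And>t. t \<in> {0<..<T} \<Longrightarrow> \<bar>E t\<bar> \<le> B"
    using bounded_on_interval[OF E, of T] by blast
  define V where "V x = (LINT t|lborel. E t *\<^sub>R W (t, x))" for x
  have V[measurable]: "V \<in> borel_measurable borel"
    unfolding V_def by measurable
  have swap: "integrable (lborel \<Otimes>\<^sub>M lborel) (\<lambda>(x, t). (norm (W (t, x)))\<^sup>2)"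
    using lborel_pair.integrable_product_swap[OF W2] .
  define c where "c = measure (lebesgue_on {0<..<T}) (space (lebesgue_on {0<..<T}))"
  interpret finite_measure "lebesgue_on {0<..<T}"
    by (rule finite_measure_lebesgue_on) simp
  have "integrable lborel (\<lambda>x. c * (B\<^sup>2 * (LINT t|lborel. (norm (W (t, x)))\<^sup>2)))"
    using lborel_pair.integrable_fst'[OF swap] by simp
  then have "integrable lborel (\<lambda>x. (norm (V x))\<^sup>2)"
  proof (rule Bochner_Integration.integrable_bound)
    have "AE x in lborel. integrable lborel (\<lambda>t. (norm (W (t, x)))\<^sup>2)"
      using lborel_pair.AE_integrable_fst'[OF swap] by simp
    then show "AE x in lborel. norm ((norm (V x))\<^sup>2)
        \<le> norm (c * (B\<^sup>2 * (LINT t|lborel. (norm (W (t, x)))\<^sup>2)))"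
    proof eventually_elim
      case (elim x)
      define h where "h t = norm (E t *\<^sub>R W (t, x))" for t
      have [measurable]: "h \<in> borel_measurable borel"
        unfolding h_def by measurable
      have h2: "(h t)\<^sup>2 \<le> B\<^sup>2 * (norm (W (t, x)))\<^sup>2" for t
      proof (cases "t \<in> {0<..<T}")
        case True
        then have "(h t)\<^sup>2 \<le> (B * norm (W (t, x)))\<^sup>2"
          unfolding h_def using B by (intro power_mono) (auto intro: mult_right_mono)
        then show ?thesis by (simp add: power_mult_distrib)
      qed (simp add: h_def W0)
      have h2i: "integrable lborel (\<lambda>t. (h t)\<^sup>2)"
        by (rule Bochner_Integration.integrable_bound[of _ "\<lambda>t. B\<^sup>2 * (norm (W (t, x)))\<^sup>2"])
           (use elim h2 in auto)
      \<comment> \<open>\<open>square_integral_le\<close> needs a finite measure, hence the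
        restriction to the interval; since \<open>h\<close> vanishes outside it, the integrals agree
        with those over the line.\<close>
      have hJ: "h t = indicator {0<..<T} t *\<^sub>R h t" for t
        using W0[of t x] by (auto simp: h_def indicator_def)
      have J: "integrable (lebesgue_on {0<..<T}) (\<lambda>t. (h t)\<^sup>2)"
        using h2i integrable_mult_indicator[of "{0<..<T}" lebesgue "\<lambda>t. (h t)\<^sup>2"]
        by (simp add: integrable_restrict_space integrable_completion)
      have hm: "h \<in> borel_measurable (lebesgue_on {0<..<T})"
        by (intro measurable_restrict_space1 measurable_completion) simp
      have hJi: "integrable (lebesgue_on {0<..<T}) h"
        by (rule square_integrable_imp_integrable[OF hm J])
      have eq: "(LINT t|lebesgue_on {0<..<T}. h t) = (LINT t|lborel. h t)"
        by (subst integral_lebesgue_on_eq_lborel) (simp_all only: hJ[symmetric], auto)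
      have h2J: "(h t)\<^sup>2 = indicator {0<..<T} t *\<^sub>R (h t)\<^sup>2" for t
        using W0[of t x] by (auto simp: h_def indicator_def)
      have eq2: "(LINT t|lebesgue_on {0<..<T}. (h t)\<^sup>2) = (LINT t|lborel. (h t)\<^sup>2)"
        by (subst integral_lebesgue_on_eq_lborel) (simp_all only: h2J[symmetric], auto)
      have "(norm (V x))\<^sup>2 \<le> (LINT t|lborel. h t)\<^sup>2"
        unfolding V_def h_def by (intro power_mono integral_norm_bound) auto
      also have "\<dots> \<le> c * (LINT t|lborel. (h t)\<^sup>2)"
        using square_integral_le[OF hJi J] unfolding eq eq2 c_def .
      also have "\<dots> \<le> c * (LINT t|lborel. B\<^sup>2 * (norm (W (t, x)))\<^sup>2)"
        using h2i elim h2 by (intro mult_left_mono integral_mono) (auto simp: c_def)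
      finally show ?case
        by (simp add: c_def)
    qed
  qed measurable
  moreover have ae: "AE x in lebesgue. V x = (LINT t|lebesgue_on {0<..<T}. E t *\<^sub>R w t x)"
    using L2_L2_time_integral_representative[OF W W0 wW E] by (auto simp: V_def elim: eventually_mono)
  moreover have "V \<in> borel_measurable lebesgue"
    by (intro measurable_completion) simp
  ultimately show ?thesis
    unfolding L2_fun_def
    by (auto intro: borel_measurable_AE[OF _ ae] integrable_lebesgue_cong_AE[of "\<lambda>x. (norm (V x))\<^sup>2"]
        simp: integrable_completion elim: eventually_mono)
qed

text \<open>Fubini for the product of \<open>E t\<close> with the inner product of
  \<open>W (t, x)\<close> and \<open>G x\<close>, dominated by the sum of the two squares.\<close>

lemma L2_L2_pairing:
  fixes w :: "real \<Rightarrow> 'a::euclidean_space \<Rightarrow> 'b::euclidean_space"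
  assumes w: "L2_L2 T w" and g: "L2_fun lebesgue g"
  shows "integrable (lebesgue_on {0<..<T}) (\<lambda>t. LINT x|lebesgue. w t x \<bullet> g x)"
    and "continuous_on UNIV E \<Longrightarrow>
      (LINT t|lebesgue_on {0<..<T}. E t * (LINT x|lebesgue. w t x \<bullet> g x))
      = (LINT x|lebesgue. (LINT t|lebesgue_on {0<..<T}. E t *\<^sub>R w t x) \<bullet> g x)"
proof -
  let ?J = "{0<..<T}"
  obtain W where W[measurable]: "W \<in> borel_measurable (borel \<Otimes>\<^sub>M borel)"
    and W0: "\<And>t x. t \<notin> {0<..<T} \<Longrightarrow> W (t, x) = 0"
    and W2: "integrable (lborel \<Otimes>\<^sub>M lborel) (\<lambda>p. (norm (W p))\<^sup>2)"
    and wW1: "AE t in lebesgue_on {0<..<T}. AE x in lebesgue. w t x = W (t, x)"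
    and wW2: "AE x in lebesgue. AE t in lebesgue_on {0<..<T}. w t x = W (t, x)"
    by (rule L2_L2_representative[OF w]) blast
  obtain G where G[measurable]: "G \<in> borel_measurable borel" and gG: "AE x in lborel. g x = G x"
    using g lebesgue_borel_representative[of g] by (auto simp: L2_fun_def)
  have "integrable lebesgue (\<lambda>x. (norm (G x))\<^sup>2)"
    using g gG by (auto simp: L2_fun_def AE_completion_iff elim: eventually_mono
        intro!: integrable_lebesgue_cong_AE[of "\<lambda>x. (norm (g x))\<^sup>2"])
  then have G2: "integrable lborel (\<lambda>x. (norm (G x))\<^sup>2)"
    by (simp add: integrable_completion)
  have Jint: "integrable lborel (\<lambda>t. indicator ?J t * c :: real)" for c
    by (intro integrable_mult_left integrable_real_indicator) (use emeasure_bounded_finite[of ?J] in auto)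
  \<comment> \<open>The indicator is essential: the square of \<open>G\<close> is constant in time
    and in general not integrable over the whole line.\<close>
  have dom: "integrable (lborel \<Otimes>\<^sub>M lborel) (\<lambda>(t, x). indicator ?J t * (norm (G x))\<^sup>2 :: real)"
    by (rule lborel_pair.Fubini_integrable) (use G2 Jint in auto)
  have ab: "\<bar>a \<bullet> b\<bar> \<le> (norm a)\<^sup>2 + (norm b)\<^sup>2" for a b :: 'b
  proof -
    have "\<bar>a \<bullet> b\<bar> \<le> norm a * norm b"
      by (rule Cauchy_Schwarz_ineq2)
    also have "\<dots> \<le> (norm a)\<^sup>2 + (norm b)\<^sup>2"
      using sum_squares_bound[of "norm a" "norm b"] mult_nonneg_nonneg[OF norm_ge_zero[of a] norm_ge_zero[of b]]
      by linarith
    finally show ?thesis .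
  qed
  have F: "integrable (lborel \<Otimes>\<^sub>M lborel) (\<lambda>(t, x). E t * (W (t, x) \<bullet> G x))" if E: "continuous_on UNIV E" for E
  proof -
    have [measurable]: "E \<in> borel_measurable borel"
      by (rule borel_measurable_continuous_onI[OF E])
    obtain B where B: "B \<ge> 0" "\<And>t. t \<in> {0<..<T} \<Longrightarrow> \<bar>E t\<bar> \<le> B"
      using bounded_on_interval[OF E, of T] by blast
    show ?thesis
    proof (rule Bochner_Integration.integrable_bound)
      show "integrable (lborel \<Otimes>\<^sub>M lborel)
          (\<lambda>p. B * ((norm (W p))\<^sup>2 + (case p of (t, x) \<Rightarrow> indicator ?J t * (norm (G x))\<^sup>2)))"
        using W2 dom by (intro integrable_mult_right Bochner_Integration.integrable_add)
      have "\<bar>E t * (W (t, x) \<bullet> G x)\<bar> \<le> B * ((norm (W (t, x)))\<^sup>2 + indicator ?J t * (norm (G x))\<^sup>2)" for t x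
        using B ab[of "W (t, x)" "G x"] by (cases "t \<in> ?J") (auto simp: abs_mult W0 intro!: mult_mono)
      then show "AE p in lborel \<Otimes>\<^sub>M lborel. norm (case p of (t, x) \<Rightarrow> E t * (W (t, x) \<bullet> G x))
          \<le> norm (B * ((norm (W p))\<^sup>2 + (case p of (t, x) \<Rightarrow> indicator ?J t * (norm (G x))\<^sup>2)))"
        by (intro AE_I2) (auto intro: order_trans[OF _ abs_ge_self])
    qed measurable
  qed
  define h where "h t = (LINT x|lborel. W (t, x) \<bullet> G x)" for t
  have h[measurable]: "h \<in> borel_measurable borel"
    unfolding h_def by measurable
  have wh: "AE t in lebesgue_on ?J. h t = (LINT x|lebesgue. w t x \<bullet> g x)"
    using wW1
  proof eventually_elim
    case (elim t)
    have "(LINT x|lebesgue. w t x \<bullet> g x) = (LINT x|lebesgue. W (t, x) \<bullet> G x)"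
    proof (rule integral_lebesgue_cong_AE)
      have "AE x in lebesgue. g x = G x"
        using gG by (simp add: AE_completion_iff)
      then show "AE x in lebesgue. w t x \<bullet> g x = W (t, x) \<bullet> G x"
        using elim by eventually_elim simp
    qed
    also have "\<dots> = h t"
      unfolding h_def by (rule integral_completion) simp
    finally show ?case ..
  qed
  have "integrable lborel h"
    using lborel_pair.integrable_fst'[OF F[of "\<lambda>_. 1"]] by (simp add: h_def[abs_def])
  then have "integrable lebesgue h"
    by (simp add: integrable_completion)
  then have "integrable (lebesgue_on ?J) h"
    using integrable_mult_indicator[of ?J lebesgue h] by (simp add: integrable_restrict_space)
  then show "integrable (lebesgue_on {0<..<T}) (\<lambda>t. LINT x|lebesgue. w t x \<bullet> g x)"
    by (rule integrable_lebesgue_on_cong_AE[OF _ wh, rotated]) simp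
  assume E: "continuous_on UNIV E"
  have [measurable]: "E \<in> borel_measurable borel"
    by (rule borel_measurable_continuous_onI[OF E])
  obtain B where B: "B \<ge> 0" "\<And>t. t \<in> {0<..<T} \<Longrightarrow> \<bar>E t\<bar> \<le> B"
    using bounded_on_interval[OF E, of T] by blast
  have swap: "integrable (lborel \<Otimes>\<^sub>M lborel) (\<lambda>(x, t). (norm (W (t, x)))\<^sup>2)"
    using lborel_pair.integrable_product_swap[OF W2] .
  have "AE x in lborel. integrable lborel (\<lambda>t. (norm (W (t, x)))\<^sup>2)"
    using lborel_pair.AE_integrable_fst'[OF swap] by simp
  then have WG: "AE x in lborel. (LINT t|lborel. E t *\<^sub>R W (t, x)) \<bullet> G x = (LINT t|lborel. E t * (W (t, x) \<bullet> G x))"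
  proof eventually_elim
    case (elim x)
    \<comment> \<open>Taking the fixed vector \<open>G x\<close> out of the time integral requires
      integrability in t. It follows from y \<le> y^2 + 1 for y the norm of W, used on the bounded
      interval.\<close>
    have "norm (E t *\<^sub>R W (t, x)) \<le> B * ((norm (W (t, x)))\<^sup>2 + indicator ?J t * 1)" for t
    proof (cases "t \<in> ?J")
      case True
      have "norm (W (t, x)) \<le> (norm (W (t, x)))\<^sup>2 + 1"
        using sum_squares_bound[of "norm (W (t, x))" 1] norm_ge_zero[of "W (t, x)"]
        unfolding power_one mult_1_right by linarith
      then have "\<bar>E t\<bar> * norm (W (t, x)) \<le> B * ((norm (W (t, x)))\<^sup>2 + 1)"
        using True B by (intro mult_mono) auto
      then show ?thesis
        using True by simp
    qed (use B W0 in auto)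
    note bound = this
    have "integrable lborel (\<lambda>t. E t *\<^sub>R W (t, x))"
    proof (rule Bochner_Integration.integrable_bound)
      show "integrable lborel (\<lambda>t. B * ((norm (W (t, x)))\<^sup>2 + indicator ?J t * 1))"
        using elim Jint[of 1] by (intro integrable_mult_right Bochner_Integration.integrable_add)
      show "AE t in lborel. norm (E t *\<^sub>R W (t, x)) \<le> norm (B * ((norm (W (t, x)))\<^sup>2 + indicator ?J t * 1))"
        by (intro AE_I2 order_trans[OF bound]) simp
    qed measurable
    then have "(LINT t|lborel. (E t *\<^sub>R W (t, x)) \<bullet> G x) = (LINT t|lborel. E t *\<^sub>R W (t, x)) \<bullet> G x"
      by (intro integral_inner_left)
    then show ?case by simp
  qed
  have "(LINT t|lebesgue_on ?J. E t * (LINT x|lebesgue. w t x \<bullet> g x)) = (LINT t|lebesgue_on ?J. E t * h t)"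
    using wh by (intro integral_lebesgue_on_cong_AE) (auto elim: eventually_mono)
  also have "\<dots> = (LINT t|lborel. indicator ?J t *\<^sub>R (E t * h t))"
    by (rule integral_lebesgue_on_eq_lborel) auto
  also have "\<dots> = (LINT t|lborel. E t * h t)"
  proof (rule Bochner_Integration.integral_cong[OF refl])
    show "indicator ?J t *\<^sub>R (E t * h t) = E t * h t" for t
      by (cases "t \<in> ?J") (simp_all add: h_def W0)
  qed
  also have "\<dots> = (LINT t|lborel. LINT x|lborel. E t * (W (t, x) \<bullet> G x))"
    by (simp add: h_def)
  also have "\<dots> = (LINT x|lborel. LINT t|lborel. E t * (W (t, x) \<bullet> G x))"
    by (rule lborel_pair.Fubini_integral[OF F[OF E], symmetric])
  also have "\<dots> = (LINT x|lborel. (LINT t|lborel. E t *\<^sub>R W (t, x)) \<bullet> G x)"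
    using WG by (intro integral_cong_AE) (auto elim: eventually_mono)
  also have "\<dots> = (LINT x|lebesgue. (LINT t|lborel. E t *\<^sub>R W (t, x)) \<bullet> G x)"
    by (rule integral_completion[symmetric]) measurable
  also have "\<dots> = (LINT x|lebesgue. (LINT t|lebesgue_on ?J. E t *\<^sub>R w t x) \<bullet> g x)"
  proof (rule integral_lebesgue_cong_AE)
    have "AE x in lebesgue. g x = G x"
      using gG by (simp add: AE_completion_iff)
    moreover have "AE x in lebesgue. (LINT t|lebesgue_on ?J. E t *\<^sub>R w t x) = (LINT t|lborel. E t *\<^sub>R W (t, x))"
      by (rule L2_L2_time_integral_representative[OF W _ wW2 E]) (rule W0)
    ultimately show "AE x in lebesgue. (LINT t|lborel. E t *\<^sub>R W (t, x)) \<bullet> G x = (LINT t|lebesgue_on ?J. E t *\<^sub>R w t x) \<bullet> g x"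
      by eventually_elim simp
  qed
  finally show "(LINT t|lebesgue_on {0<..<T}. E t * (LINT x|lebesgue. w t x \<bullet> g x))
      = (LINT x|lebesgue. (LINT t|lebesgue_on {0<..<T}. E t *\<^sub>R w t x) \<bullet> g x)" .
qed

section \<open>Square integrable functions and the dual of the Sobolev space\<close>

lemma L2_fun_scaleR: "L2_fun M f \<Longrightarrow> L2_fun M (\<lambda>x. c *\<^sub>R f x)"
  by (auto simp: L2_fun_def power_mult_distrib)

lemma L2_fun_inner:
  assumes f: "L2_fun M f" and g: "L2_fun M g"
  shows "integrable M (\<lambda>x. f x \<bullet> g x)"
proof (rule Bochner_Integration.integrable_bound)
  show "integrable M (\<lambda>x. (norm (f x))\<^sup>2 + (norm (g x))\<^sup>2)"
    using f g by (simp add: L2_fun_def)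
  have [measurable]: "f \<in> borel_measurable M" "g \<in> borel_measurable M"
    using f g by (auto simp: L2_fun_def)
  show "(\<lambda>x. f x \<bullet> g x) \<in> borel_measurable M"
    by measurable
  have "\<bar>f x \<bullet> g x\<bar> \<le> (norm (f x))\<^sup>2 + (norm (g x))\<^sup>2" for x
    using Cauchy_Schwarz_ineq2[of "f x" "g x"] sum_squares_bound[of "norm (f x)" "norm (g x)"]
      mult_nonneg_nonneg[OF norm_ge_zero[of "f x"] norm_ge_zero[of "g x"]] by linarith
  then show "AE x in M. norm (f x \<bullet> g x) \<le> norm ((norm (f x))\<^sup>2 + (norm (g x))\<^sup>2)"
    by (auto intro!: AE_I2 order_trans[OF _ abs_ge_self])
qed

lemma L2_fun_mult: "L2_fun M f \<Longrightarrow> L2_fun M g \<Longrightarrow> integrable M (\<lambda>x. f x * g x :: real)"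
  using L2_fun_inner[of M f g] by simp

lemma L2_fun_add:
  assumes f: "L2_fun M f" and g: "L2_fun M g"
  shows "L2_fun M (\<lambda>x. f x + g x)"
proof -
  have "integrable M (\<lambda>x. (f x \<bullet> f x + g x \<bullet> g x) + 2 * (f x \<bullet> g x))"
    using L2_fun_inner[OF f f] L2_fun_inner[OF g g] L2_fun_inner[OF f g] by simp
  also have "(\<lambda>x. (f x \<bullet> f x + g x \<bullet> g x) + 2 * (f x \<bullet> g x)) = (\<lambda>x. (norm (f x + g x))\<^sup>2)"
    by (simp add: power2_norm_eq_inner inner_simps inner_commute fun_eq_iff)
  finally show ?thesis
    using f g by (auto simp: L2_fun_def)
qed

lemma L2_fun_diff: "L2_fun M f \<Longrightarrow> L2_fun M g \<Longrightarrow> L2_fun M (\<lambda>x. f x - g x)"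
  using L2_fun_add[of M f "\<lambda>x. (-1) *\<^sub>R g x"] L2_fun_scaleR[of M g "-1"] by simp

lemma L2_fun_bounded_scaleR:
  fixes s :: "'a \<Rightarrow> real"
  assumes f: "L2_fun M f" and s: "s \<in> borel_measurable M" "AE x in M. \<bar>s x\<bar> \<le> B"
  shows "L2_fun M (\<lambda>x. s x *\<^sub>R f x)"
  unfolding L2_fun_def
proof
  have [measurable]: "f \<in> borel_measurable M"
    using f by (auto simp: L2_fun_def)
  note s(1)[measurable]
  show "(\<lambda>x. s x *\<^sub>R f x) \<in> borel_measurable M"
    by measurable
  show "integrable M (\<lambda>x. (norm (s x *\<^sub>R f x))\<^sup>2)"
  proof (rule Bochner_Integration.integrable_bound)
    show "integrable M (\<lambda>x. B\<^sup>2 * (norm (f x))\<^sup>2)"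
      using f by (simp add: L2_fun_def)
    show "AE x in M. norm ((norm (s x *\<^sub>R f x))\<^sup>2) \<le> norm (B\<^sup>2 * (norm (f x))\<^sup>2)"
      using s(2)
    proof eventually_elim
      case (elim x)
      then have "(s x)\<^sup>2 \<le> B\<^sup>2"
        using power_mono[of "\<bar>s x\<bar>" B 2] by simp
      then show ?case
        by (simp add: power_mult_distrib mult_right_mono)
    qed
  qed measurable
qed

lemma L2_norm_nonneg: "0 \<le> L2_norm f"
  by (simp add: L2_norm_def)

lemma L2_norm_power2: "(L2_norm f)\<^sup>2 = (LINT x|lebesgue. (f x)\<^sup>2)"
  by (simp add: L2_norm_def)

lemma L2_norm_Cauchy_Schwarz:
  assumes f: "L2_fun lebesgue f" and g: "L2_fun lebesgue g"
  shows "\<bar>LINT x|lebesgue. f x * g x\<bar> \<le> L2_norm f * L2_norm g"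
proof -
  define a b c where "a = (LINT x|lebesgue. (f x)\<^sup>2)" and "b = (LINT x|lebesgue. (g x)\<^sup>2)"
    and "c = (LINT x|lebesgue. f x * g x)"
  have int: "integrable lebesgue (\<lambda>x. (f x)\<^sup>2)" "integrable lebesgue (\<lambda>x. (g x)\<^sup>2)" "integrable lebesgue (\<lambda>x. f x * g x)"
    using f g L2_fun_mult[OF f g] by (auto simp: L2_fun_def)
  have b0: "b \<ge> 0"
    by (simp add: b_def)
  have "c\<^sup>2 \<le> a * b"
  \<comment> \<open>If b is 0 then \<open>g\<close> vanishes almost everywhere; otherwise the
    integral of (b f - c g)^2 equals b (a b - c^2), and b can be cancelled.\<close>
  proof (cases "b = 0")
    case True
    then have "AE x in lebesgue. (g x)\<^sup>2 = 0"
      using int(2) integral_nonneg_eq_0_iff_AE[OF int(2)] by (simp add: b_def)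
    then have "c = 0"
      unfolding c_def by (intro integral_eq_zero_AE) (auto elim: eventually_mono)
    then show ?thesis using True by simp
  next
    case False
    have "0 \<le> (LINT x|lebesgue. (b * f x - c * g x)\<^sup>2)"
      by simp
    also have "\<dots> = (LINT x|lebesgue. b\<^sup>2 * (f x)\<^sup>2 - 2 * b * c * (f x * g x) + c\<^sup>2 * (g x)\<^sup>2)"
      by (simp add: power2_eq_square algebra_simps)
    also have "\<dots> = b\<^sup>2 * a - 2 * b * c * c + c\<^sup>2 * b"
      using int by (simp add: a_def b_def c_def)
    also have "\<dots> = b * (a * b - c\<^sup>2)"
      by (simp add: power2_eq_square algebra_simps)
    finally show ?thesis
      using b0 False by (simp add: zero_le_mult_iff)
  qed
  then have "sqrt (c\<^sup>2) \<le> sqrt (a * b)"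
    by (rule real_sqrt_le_mono)
  then show ?thesis
    by (simp add: L2_norm_def a_def b_def c_def real_sqrt_mult)
qed

section \<open>Test functions and weak gradients\<close>

lemma L2_fun_compact_support:
  fixes \<psi> :: "'a::euclidean_space \<Rightarrow> real"
  assumes \<psi>: "continuous_on UNIV \<psi>" and K: "compact K" "\<And>x. x \<notin> K \<Longrightarrow> \<psi> x = 0"
  shows "L2_fun lebesgue \<psi>"
proof -
  have [measurable]: "\<psi> \<in> borel_measurable borel"
    by (rule borel_measurable_continuous_onI[OF \<psi>])
  have "integrable lborel (\<lambda>x. indicator K x *\<^sub>R (\<psi> x)\<^sup>2)"
    by (intro borel_integrable_compact K continuous_intros continuous_on_subset[OF \<psi>]) auto
  also have "(\<lambda>x. indicator K x *\<^sub>R (\<psi> x)\<^sup>2) = (\<lambda>x. (\<psi> x)\<^sup>2)"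
    using K by (auto simp: indicator_def fun_eq_iff)
  finally show ?thesis
    by (auto simp: L2_fun_def integrable_completion intro!: measurable_completion)
qed

text \<open>The integrals in \<open>weak_gradient\<close> may be added or exchanged only when the
  products are integrable; this supplies the square integrability of the test side. The derivative
  vanishes off the support because the function is locally zero there.\<close>

lemma test_function_L2:
  fixes \<phi> :: "'a::euclidean_space \<Rightarrow> real"
  assumes \<phi>: "test_function UNIV \<phi>"
  shows "L2_fun lebesgue \<phi>"
    and "b \<in> Basis \<Longrightarrow> L2_fun lebesgue (\<lambda>x. frechet_derivative \<phi> (at x) b)"
proof -
  let ?K = "closure {x. \<phi> x \<noteq> 0}"
  have C: "C_k 0 \<phi>" "C_k (Suc 0) \<phi>" and K: "compact ?K"
    using \<phi> unfolding test_function_def by blast+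
  show "L2_fun lebesgue \<phi>"
    by (rule L2_fun_compact_support[OF _ K]) (use C closure_subset[of "{x. \<phi> x \<noteq> 0}"] in auto)
  assume b: "b \<in> Basis"
  show "L2_fun lebesgue (\<lambda>x. frechet_derivative \<phi> (at x) b)"
  proof (rule L2_fun_compact_support[OF _ K])
    show "continuous_on UNIV (\<lambda>x. frechet_derivative \<phi> (at x) b)"
      using C b by auto
    fix x assume x: "x \<notin> ?K"
    have "((\<lambda>_. 0) has_derivative (\<lambda>_. 0)) (at x)"
      by simp
    then have "(\<phi> has_derivative (\<lambda>_. 0)) (at x)"
      by (rule has_derivative_transform_within_open[of _ _ x UNIV "- ?K"])
         (use x closure_subset[of "{x. \<phi> x \<noteq> 0}"] in auto)
    then show "frechet_derivative \<phi> (at x) b = 0"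
      by (simp flip: frechet_derivative_at)
  qed
qed

lemma L2_fun_inner_const: "L2_fun M g \<Longrightarrow> L2_fun M (\<lambda>x. g x \<bullet> b)"
proof -
  assume g: "L2_fun M g"
  then have [measurable]: "g \<in> borel_measurable M"
    by (simp add: L2_fun_def)
  have "integrable M (\<lambda>x. (g x \<bullet> b)\<^sup>2)"
  proof (rule Bochner_Integration.integrable_bound)
    show "integrable M (\<lambda>x. (norm b)\<^sup>2 * (norm (g x))\<^sup>2)"
      using g by (simp add: L2_fun_def)
    have "(g x \<bullet> b)\<^sup>2 \<le> (norm b)\<^sup>2 * (norm (g x))\<^sup>2" for x
      using Cauchy_Schwarz_ineq[of "g x" b] by (simp add: power2_norm_eq_inner mult.commute)
    then show "AE x in M. norm ((g x \<bullet> b)\<^sup>2) \<le> norm ((norm b)\<^sup>2 * (norm (g x))\<^sup>2)"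
      by auto
  qed measurable
  then show ?thesis
    by (simp add: L2_fun_def)
qed

lemma H1_linear_combination:
  assumes p: "H1 p g" and q: "H1 q h"
  shows "H1 (\<lambda>x. a * p x + b * q x) (\<lambda>x. a *\<^sub>R g x + b *\<^sub>R h x)"
proof -
  note L = p[unfolded H1_def, THEN conjunct1] p[unfolded H1_def, THEN conjunct2, THEN conjunct1]
    q[unfolded H1_def, THEN conjunct1] q[unfolded H1_def, THEN conjunct2, THEN conjunct1]
  have "weak_gradient (\<lambda>x. a * p x + b * q x) (\<lambda>x. a *\<^sub>R g x + b *\<^sub>R h x)"
    unfolding weak_gradient_def
  proof (intro allI impI ballI)
    fix \<phi> :: "'a \<Rightarrow> real" and e :: 'a
    assume \<phi>: "test_function UNIV \<phi>" and e: "e \<in> Basis"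
    note T = test_function_L2(1)[OF \<phi>] test_function_L2(2)[OF \<phi> e]
    have wp: "(LINT x|lebesgue. p x * frechet_derivative \<phi> (at x) e) = - (LINT x|lebesgue. (g x \<bullet> e) * \<phi> x)"
      and wq: "(LINT x|lebesgue. q x * frechet_derivative \<phi> (at x) e) = - (LINT x|lebesgue. (h x \<bullet> e) * \<phi> x)"
      using p q \<phi> e by (auto simp: H1_def weak_gradient_def)
    have "(LINT x|lebesgue. (a * p x + b * q x) * frechet_derivative \<phi> (at x) e)
      = (LINT x|lebesgue. a * (p x * frechet_derivative \<phi> (at x) e) + b * (q x * frechet_derivative \<phi> (at x) e))"
      by (simp add: algebra_simps)
    also have "\<dots> = a * (LINT x|lebesgue. p x * frechet_derivative \<phi> (at x) e)
        + b * (LINT x|lebesgue. q x * frechet_derivative \<phi> (at x) e)"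
      using L T by (simp add: L2_fun_mult)
    also have "\<dots> = - (a * (LINT x|lebesgue. (g x \<bullet> e) * \<phi> x) + b * (LINT x|lebesgue. (h x \<bullet> e) * \<phi> x))"
      unfolding wp wq by simp
    also have "a * (LINT x|lebesgue. (g x \<bullet> e) * \<phi> x) + b * (LINT x|lebesgue. (h x \<bullet> e) * \<phi> x)
      = (LINT x|lebesgue. a * ((g x \<bullet> e) * \<phi> x) + b * ((h x \<bullet> e) * \<phi> x))"
      using L T by (simp add: L2_fun_mult L2_fun_inner_const)
    also have "\<dots> = (LINT x|lebesgue. ((a *\<^sub>R g x + b *\<^sub>R h x) \<bullet> e) * \<phi> x)"
      by (simp add: algebra_simps inner_simps)
    finally show "(LINT x|lebesgue. (a * p x + b * q x) * frechet_derivative \<phi> (at x) e)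
        = - (LINT x|lebesgue. ((a *\<^sub>R g x + b *\<^sub>R h x) \<bullet> e) * \<phi> x)" .
  qed
  then show ?thesis
    using L2_fun_add[OF L2_fun_scaleR[OF L(1), of a] L2_fun_scaleR[OF L(3), of b]]
      L2_fun_add[OF L2_fun_scaleR[OF L(2), of a] L2_fun_scaleR[OF L(4), of b]]
    by (simp add: H1_def)
qed

lemma H1_scale: "H1 p g \<Longrightarrow> H1 (\<lambda>x. a * p x) (\<lambda>x. a *\<^sub>R g x)"
  using H1_linear_combination[of p g p g a 0] by simp

lemma H1_diff: "H1 p g \<Longrightarrow> H1 q h \<Longrightarrow> H1 (\<lambda>x. p x - q x) (\<lambda>x. g x - h x)"
  using H1_linear_combination[of p g q h 1 "-1"] by simp

text \<open>The defining identity of the weak gradient holds at almost every time and is a spatial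
  pairing with a fixed square integrable function, so Fubini carries it through the time integral.
  The gradient is paired with the vector field \<open>\<phi> x *\<^sub>R e\<close> to fit the same
  pairing lemma.\<close>

lemma H1_time_integral:
  assumes u: "L2_H1 T u Du" and E: "continuous_on UNIV E"
  shows "H1 (\<lambda>x. LINT t|lebesgue_on {0<..<T}. E t * u t x) (\<lambda>x. LINT t|lebesgue_on {0<..<T}. E t *\<^sub>R Du t x)"
proof -
  let ?J = "{0<..<T}"
  have u2: "L2_L2 T u" "L2_L2 T Du" and ae: "AE t in lebesgue_on ?J. H1 (u t) (Du t)"
    using u by (auto simp: L2_H1_def)
  have "weak_gradient (\<lambda>x. LINT t|lebesgue_on ?J. E t * u t x) (\<lambda>x. LINT t|lebesgue_on ?J. E t *\<^sub>R Du t x)"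
    unfolding weak_gradient_def
  proof (intro allI impI ballI)
    fix \<phi> :: "'a \<Rightarrow> real" and e :: 'a
    assume \<phi>: "test_function UNIV \<phi>" and e: "e \<in> Basis"
    have \<phi>e: "L2_fun lebesgue (\<lambda>x. \<phi> x *\<^sub>R e)"
      using test_function_L2(1)[OF \<phi>] e by (auto simp: L2_fun_def intro: borel_measurable_scaleR)
    have "(LINT x|lebesgue. (LINT t|lebesgue_on ?J. E t * u t x) * frechet_derivative \<phi> (at x) e)
      = (LINT t|lebesgue_on ?J. E t * (LINT x|lebesgue. u t x * frechet_derivative \<phi> (at x) e))"
      using L2_L2_pairing(2)[OF u2(1) test_function_L2(2)[OF \<phi> e] E] by simp
    also have "\<dots> = (LINT t|lebesgue_on ?J. - (E t * (LINT x|lebesgue. Du t x \<bullet> (\<phi> x *\<^sub>R e))))"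
    proof (rule integral_lebesgue_on_cong_AE)
      show "AE t in lebesgue_on ?J. E t * (LINT x|lebesgue. u t x * frechet_derivative \<phi> (at x) e)
          = - (E t * (LINT x|lebesgue. Du t x \<bullet> (\<phi> x *\<^sub>R e)))"
        using ae
      proof eventually_elim
        case (elim t)
        then have "(LINT x|lebesgue. u t x * frechet_derivative \<phi> (at x) e) = - (LINT x|lebesgue. (Du t x \<bullet> e) * \<phi> x)"
          using \<phi> e by (simp add: H1_def weak_gradient_def)
        then show ?case by (simp add: mult.commute)
      qed
    qed simp
    also have "\<dots> = - (LINT x|lebesgue. (LINT t|lebesgue_on ?J. E t *\<^sub>R Du t x) \<bullet> (\<phi> x *\<^sub>R e))"
      using L2_L2_pairing(2)[OF u2(2) \<phi>e E] by simp
    finally show "(LINT x|lebesgue. (LINT t|lebesgue_on ?J. E t * u t x) * frechet_derivative \<phi> (at x) e)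
      = - (LINT x|lebesgue. ((LINT t|lebesgue_on ?J. E t *\<^sub>R Du t x) \<bullet> e) * \<phi> x)"
      by (simp add: mult.commute)
  qed
  then show ?thesis
    using L2_L2_time_integral[OF u2(1) E] L2_L2_time_integral[OF u2(2) E] by (simp add: H1_def)
qed

section \<open>Functionals on H^1 and continuity of pairings\<close>

lemma H1_norm_nonneg: "0 \<le> H1_norm p g"
  by (simp add: H1_norm_def)

lemma H1_norm_scale: "H1_norm (\<lambda>x. a * p x) (\<lambda>x. a *\<^sub>R g x) = \<bar>a\<bar> * H1_norm p g"
proof -
  have "H1_norm (\<lambda>x. a * p x) (\<lambda>x. a *\<^sub>R g x)
    = sqrt (a\<^sup>2 * ((LINT x|lebesgue. (p x)\<^sup>2) + (LINT x|lebesgue. (norm (g x))\<^sup>2)))"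
    by (simp add: H1_norm_def power_mult_distrib distrib_left)
  then show ?thesis
    by (simp add: H1_norm_def real_sqrt_mult)
qed

lemma H1_dual_scale:
  assumes "H1_dual F" "H1 \<phi> g"
  shows "F (\<lambda>x. a * \<phi> x) = a * F \<phi>"
proof -
  have "F (\<lambda>x. a * \<phi> x + 0 * \<phi> x) = a * F \<phi> + 0 * F \<phi>"
    using assms unfolding H1_dual_def by blast
  then show ?thesis by simp
qed

text \<open>\<open>Sup\<close> over the reals is informative only for a nonempty set bounded above,
  and the bound comes from \<open>H1_dual\<close>. Homogeneity then scales to the unit ball, except
  for elements of norm 0, where that bound already forces the value 0.\<close>

lemma H1_dual_le_norm:
  assumes F: "H1_dual F" and \<phi>: "H1 \<phi> g"
  shows "\<bar>F \<phi>\<bar> \<le> H1_dual_norm F * H1_norm \<phi> g"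
proof -
  obtain K where K: "\<And>\<phi> g. H1 \<phi> g \<Longrightarrow> \<bar>F \<phi>\<bar> \<le> K * H1_norm \<phi> g"
    using F unfolding H1_dual_def by blast
  show ?thesis
  proof (cases "H1_norm \<phi> g = 0")
    case True
    then show ?thesis using K[OF \<phi>] by simp
  next
    case False
    then have N: "H1_norm \<phi> g > 0"
      using H1_norm_nonneg[of \<phi> g] by linarith
    define a where "a = 1 / H1_norm \<phi> g"
    have a: "a > 0" using N by (simp add: a_def)
    let ?S = "{\<bar>F \<phi>\<bar> | \<phi> g. H1 \<phi> g \<and> H1_norm \<phi> g \<le> 1}"
    have "bdd_above ?S"
    proof (rule bdd_aboveI)
      fix y assume "y \<in> ?S"
      then obtain \<psi> h where \<psi>: "y = \<bar>F \<psi>\<bar>" "H1 \<psi> h" "H1_norm \<psi> h \<le> 1" by blast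
      have "\<bar>F \<psi>\<bar> \<le> K * H1_norm \<psi> h" using K \<psi> by blast
      also have "\<dots> \<le> \<bar>K\<bar> * 1"
        using \<psi> H1_norm_nonneg[of \<psi> h] by (intro mult_mono) auto
      finally show "y \<le> \<bar>K\<bar>" using \<psi> by simp
    qed
    moreover have "\<bar>F (\<lambda>x. a * \<phi> x)\<bar> \<in> ?S"
    proof -
      have "H1_norm (\<lambda>x. a * \<phi> x) (\<lambda>x. a *\<^sub>R g x) \<le> 1"
        using H1_norm_scale[of a \<phi> g] N by (simp add: a_def)
      then show ?thesis
        using H1_scale[OF \<phi>, of a] by blast
    qed
    ultimately have "\<bar>F (\<lambda>x. a * \<phi> x)\<bar> \<le> H1_dual_norm F"
      unfolding H1_dual_norm_def by (rule cSup_upper[rotated])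
    then show ?thesis
      using N unfolding H1_dual_scale[OF F \<phi>] by (simp add: a_def field_simps abs_mult)
  qed
qed

lemma H1_dual_diff:
  assumes "H1_dual F" "H1_dual G"
  shows "H1_dual (\<lambda>\<phi>. F \<phi> - G \<phi>)"
proof -
  obtain K L where K: "\<And>\<phi> g. H1 \<phi> g \<Longrightarrow> \<bar>F \<phi>\<bar> \<le> K * H1_norm \<phi> g"
    and L: "\<And>\<phi> g. H1 \<phi> g \<Longrightarrow> \<bar>G \<phi>\<bar> \<le> L * H1_norm \<phi> g"
    using assms unfolding H1_dual_def by metis
  have "\<bar>F \<phi> - G \<phi>\<bar> \<le> (K + L) * H1_norm \<phi> g" if "H1 \<phi> g" for \<phi> g
    using K[OF that] L[OF that] by (simp add: distrib_right)
  moreover have "F (\<lambda>x. a * \<phi> x + b * \<psi> x) - G (\<lambda>x. a * \<phi> x + b * \<psi> x) = a * (F \<phi> - G \<phi>) + b * (F \<psi> - G \<psi>)"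
    if "H1 \<phi> g" "H1 \<psi> h" for \<phi> g \<psi> h a b
  proof -
    have "F (\<lambda>x. a * \<phi> x + b * \<psi> x) = a * F \<phi> + b * F \<psi>" "G (\<lambda>x. a * \<phi> x + b * \<psi> x) = a * G \<phi> + b * G \<psi>"
      using assms that unfolding H1_dual_def by blast+
    then show ?thesis by (simp add: algebra_simps)
  qed
  ultimately show ?thesis
    unfolding H1_dual_def by blast
qed

text \<open>Turns continuity in the dual norm into continuity of a scalar function, the form in
  which the integration by parts takes its boundary values.\<close>

lemma continuous_on_pairing_H1_dual:
  assumes V: "\<And>t. t \<in> S \<Longrightarrow> H1_dual (V t)"
    and lim: "\<And>s. s \<in> S \<Longrightarrow> ((\<lambda>t. H1_dual_norm (\<lambda>\<phi>. V t \<phi> - V s \<phi>)) \<longlongrightarrow> 0) (at s within S)"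
    and \<phi>: "H1 \<phi> g"
  shows "continuous_on S (\<lambda>t. V t \<phi>)"
  unfolding continuous_on_def
proof
  fix s assume s: "s \<in> S"
  have "((\<lambda>t. V t \<phi> - V s \<phi>) \<longlongrightarrow> 0) (at s within S)"
  proof (rule Lim_null_comparison)
    show "((\<lambda>t. H1_dual_norm (\<lambda>\<phi>. V t \<phi> - V s \<phi>) * H1_norm \<phi> g) \<longlongrightarrow> 0) (at s within S)"
      by (rule tendsto_mult_left_zero[OF lim[OF s]])
    show "\<forall>\<^sub>F t in at s within S. norm (V t \<phi> - V s \<phi>) \<le> H1_dual_norm (\<lambda>\<phi>. V t \<phi> - V s \<phi>) * H1_norm \<phi> g"
      using H1_dual_le_norm[OF H1_dual_diff \<phi>] V s by (auto simp: eventually_at_filter)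
  qed
  then show "((\<lambda>t. V t \<phi>) \<longlongrightarrow> V s \<phi>) (at s within S)"
    by (rule LIM_zero_cancel)
qed

lemma continuous_on_pairing_L2:
  assumes U: "\<And>t. t \<in> S \<Longrightarrow> L2_fun lebesgue (U t)"
    and lim: "\<And>s. s \<in> S \<Longrightarrow> ((\<lambda>t. L2_norm (\<lambda>x. U t x - U s x)) \<longlongrightarrow> 0) (at s within S)"
    and \<phi>: "L2_fun lebesgue \<phi>"
  shows "continuous_on S (\<lambda>t. LINT x|lebesgue. U t x * \<phi> x)"
  unfolding continuous_on_def
proof
  fix s assume s: "s \<in> S"
  have "((\<lambda>t. (LINT x|lebesgue. U t x * \<phi> x) - (LINT x|lebesgue. U s x * \<phi> x)) \<longlongrightarrow> 0) (at s within S)"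
  proof (rule Lim_null_comparison)
    show "((\<lambda>t. L2_norm (\<lambda>x. U t x - U s x) * L2_norm \<phi>) \<longlongrightarrow> 0) (at s within S)"
      by (rule tendsto_mult_left_zero[OF lim[OF s]])
    have "norm ((LINT x|lebesgue. U t x * \<phi> x) - (LINT x|lebesgue. U s x * \<phi> x))
       \<le> L2_norm (\<lambda>x. U t x - U s x) * L2_norm \<phi>" if t: "t \<in> S" for t
    proof -
      have "(LINT x|lebesgue. U t x * \<phi> x) - (LINT x|lebesgue. U s x * \<phi> x)
          = (LINT x|lebesgue. (U t x - U s x) * \<phi> x)"
        using L2_fun_mult[OF U[OF t] \<phi>] L2_fun_mult[OF U[OF s] \<phi>] by (simp add: left_diff_distrib)
      then show ?thesis
        using L2_norm_Cauchy_Schwarz[OF L2_fun_diff[OF U[OF t] U[OF s]] \<phi>] by simp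
    qed
    then show "\<forall>\<^sub>F t in at s within S. norm ((LINT x|lebesgue. U t x * \<phi> x) - (LINT x|lebesgue. U s x * \<phi> x))
       \<le> L2_norm (\<lambda>x. U t x - U s x) * L2_norm \<phi>"
      by (auto simp: eventually_at_filter)
  qed
  then show "((\<lambda>t. LINT x|lebesgue. U t x * \<phi> x) \<longlongrightarrow> (LINT x|lebesgue. U s x * \<phi> x)) (at s within S)"
    by (rule LIM_zero_cancel)
qed

section \<open>The Laplace transformed equations\<close>

lemma mat_mult_vector: "mat c *v y = c *\<^sub>R (y :: real^'n)"
  by (simp add: vec_eq_iff matrix_vector_mult_def mat_def if_distrib[of "\<lambda>z. z * _"] cong: if_cong)

text \<open>The common shape of both backgrounds: a measurable scalar between positive bounds,
  almost everywhere. A scalar coefficient can be moved to the other factor of the bilinear form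
  without leaving L^2.\<close>

definition isotropic :: "(real^3 \<Rightarrow> real^3^3) \<Rightarrow> (real^3 \<Rightarrow> real) \<Rightarrow> real \<Rightarrow> real \<Rightarrow> bool" where
  "isotropic \<sigma> s c B \<longleftrightarrow> 0 < c \<and> s \<in> borel_measurable lebesgue \<and>
     (AE x in lebesgue. \<sigma> x = mat (s x) \<and> c \<le> s x \<and> s x \<le> B)"

lemma background_isotropic:
  assumes "non_layered_setting \<gamma>0 \<gamma> D B \<or> two_layered_setting \<gamma>0 \<gamma> D B"
  obtains s c K where "isotropic \<gamma>0 s c K"
  using assms
proof
  assume "non_layered_setting \<gamma>0 \<gamma> D B"
  then have "isotropic \<gamma>0 (\<lambda>_. 1) 1 1"
    by (simp add: non_layered_setting_def isotropic_def)
  then show thesis by (rule that)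
next
  assume "two_layered_setting \<gamma>0 \<gamma> D B"
  then obtain gp gm :: real where g: "gp > 0" "gm > 0"
    and up: "\<forall>x\<in>upper_half. \<gamma>0 x = mat gp" and low: "\<forall>x\<in>lower_half. \<gamma>0 x = mat gm"
    unfolding two_layered_setting_def by blast
  \<comment> \<open>On the interface the layered background is not prescribed. The value chosen for
    \<open>s\<close> there is arbitrary, as the hyperplane is a null set.\<close>
  define s where "s x = (if x $ 3 > 0 then gp else gm)" for x :: "real^3"
  have "s \<in> borel_measurable borel"
    unfolding s_def by measurable
  then have "s \<in> borel_measurable lebesgue"
    by (intro measurable_completion) simp
  moreover have "AE x in lebesgue. \<gamma>0 x = mat (s x) \<and> min gp gm \<le> s x \<and> s x \<le> max gp gm"
  proof (rule AE_I')
    show "{x :: real^3. x $ 3 = 0} \<in> null_sets lebesgue"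
      using negligible_standard_hyperplane_cart by (simp add: negligible_iff_null_sets)
    show "{x \<in> space lebesgue. \<not> (\<gamma>0 x = mat (s x) \<and> min gp gm \<le> s x \<and> s x \<le> max gp gm)} \<subseteq> {x. x $ 3 = 0}"
    proof
      fix x assume x: "x \<in> {x \<in> space lebesgue. \<not> (\<gamma>0 x = mat (s x) \<and> min gp gm \<le> s x \<and> s x \<le> max gp gm)}"
      show "x \<in> {x. x $ 3 = 0}"
      proof (rule ccontr)
        assume "x \<notin> {x. x $ 3 = 0}"
        then consider "x $ 3 > 0" | "x $ 3 < 0" by fastforce
        then have "\<gamma>0 x = mat (s x)"
          by cases (use up low in \<open>auto simp: upper_half_def lower_half_def s_def\<close>)
        with x show False by (auto simp: s_def split: if_splits)
      qed
    qed
  qed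
  ultimately have "isotropic \<gamma>0 s (min gp gm) (max gp gm)"
    using g by (simp add: isotropic_def)
  then show thesis by (rule that)
qed

lemma isotropic_L2_fun:
  assumes "isotropic \<sigma> s c B" "L2_fun lebesgue g"
  shows "L2_fun lebesgue (\<lambda>x. s x *\<^sub>R g x)"
proof (rule L2_fun_bounded_scaleR[OF assms(2)])
  have "AE x in lebesgue. \<sigma> x = mat (s x) \<and> c \<le> s x \<and> s x \<le> B" "0 < c"
    using assms(1) unfolding isotropic_def by blast+
  then show "AE x in lebesgue. \<bar>s x\<bar> \<le> B"
    by (auto elim: eventually_mono)
  show "s \<in> borel_measurable lebesgue"
    using assms(1) by (simp add: isotropic_def)
qed

text \<open>With the coefficient on the test gradient, the form is a pairing of \<open>p\<close>
  with a function fixed in time, so the Fubini exchange applies to it.\<close>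

lemma isotropic_form:
  assumes "isotropic \<sigma> s c B"
  shows "(LINT x|lebesgue. (\<sigma> x *v p x) \<bullet> g x) = (LINT x|lebesgue. p x \<bullet> (s x *\<^sub>R g x))"
proof (rule integral_lebesgue_cong_AE)
  show "AE x in lebesgue. (\<sigma> x *v p x) \<bullet> g x = p x \<bullet> (s x *\<^sub>R g x)"
    using assms unfolding isotropic_def by (auto elim!: eventually_mono simp: mat_mult_vector)
qed

text \<open>\<open>U\<close> and \<open>V\<close> are the values of \<open>u\<close> and \<open>\<partial>\<^sub>t u\<close> at time \<open>T\<close>.\<close>

lemma wave_laplace_trunc:
  assumes T: "0 < T" and \<sigma>: "isotropic \<sigma> s c B" and u: "weak_wave_solution \<sigma> T f u"
  obtains V U where "H1_dual V" "L2_fun lebesgue U"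
    "\<And>\<tau>. \<exists>Dw. H1 (laplace_trunc T u \<tau>) Dw \<and> (\<forall>\<phi> g. H1 \<phi> g \<longrightarrow>
        (LINT x|lebesgue. (\<sigma> x *v Dw x) \<bullet> g x) + \<tau>\<^sup>2 * (LINT x|lebesgue. laplace_trunc T u \<tau> x * \<phi> x)
        = (LINT x|lebesgue. f x * \<phi> x) - exp (- \<tau> * T) * (V \<phi> + \<tau> * (LINT x|lebesgue. U x * \<phi> x)))"
proof -
  let ?J = "lebesgue_on {0<..<T}"
  obtain Du u' u'' where Du: "L2_H1 T u Du" and u': "L2_L2 T u'" "weak_time_deriv_L2 T u u'"
    and u'': "weak_time_deriv_H1_dual T u' u''"
    and eq: "AE t in ?J. \<forall>\<phi> g. H1 \<phi> g \<longrightarrow> u'' t \<phi> + (LINT x|lebesgue. (\<sigma> x *v Du t x) \<bullet> g x) = 0"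
    and iu: "initial_value_L2 T u (\<lambda>x. 0)" and iu': "initial_value_H1_dual T u' f"
    using u unfolding weak_wave_solution_def by blast
  obtain U where U: "\<And>t. t \<in> {0..T} \<Longrightarrow> L2_fun lebesgue (U t)"
    and Ulim: "\<And>s. s \<in> {0..T} \<Longrightarrow> ((\<lambda>t. L2_norm (\<lambda>x. U t x - U s x)) \<longlongrightarrow> 0) (at s within {0..T})"
    and Uu: "AE t in ?J. AE x in lebesgue. U t x = u t x" and U0: "AE x in lebesgue. U 0 x = 0"
    using iu unfolding initial_value_L2_def by blast
  obtain V where V: "\<And>t. t \<in> {0..T} \<Longrightarrow> H1_dual (V t)"
    and Vlim: "\<And>s. s \<in> {0..T} \<Longrightarrow> ((\<lambda>t. H1_dual_norm (\<lambda>\<phi>. V t \<phi> - V s \<phi>)) \<longlongrightarrow> 0) (at s within {0..T})"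
    and Vu: "AE t in ?J. \<forall>\<phi> g. H1 \<phi> g \<longrightarrow> V t \<phi> = (LINT x|lebesgue. u' t x * \<phi> x)"
    and V0: "\<forall>\<phi> g. H1 \<phi> g \<longrightarrow> V 0 \<phi> = (LINT x|lebesgue. f x * \<phi> x)"
    using iu' unfolding initial_value_H1_dual_def by blast
  have u2: "L2_L2 T u" "L2_L2 T Du"
    using Du by (auto simp: L2_H1_def)
  show thesis
  \<comment> \<open>The values at T are chosen before \<tau> is fixed; this is what later makes the
    constant uniform in \<tau>.\<close>
  proof (rule that[of "V T" "U T"])
    show "H1_dual (V T)" "L2_fun lebesgue (U T)"
      using V[of T] U[of T] T by simp_all
    fix \<tau> :: real
    define E where "E t = exp (- \<tau> * t)" for t
    have E: "continuous_on UNIV E" "\<And>k. C_k k E"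
      unfolding E_def[abs_def] by (intro continuous_intros C_k_exp)+
    have E': "deriv E t = - \<tau> * E t" for t
      unfolding E_def by (intro DERIV_imp_deriv) (auto intro!: derivative_eq_intros)
    have w: "laplace_trunc T u \<tau> = (\<lambda>x. LINT t|?J. E t * u t x)"
      by (simp add: laplace_trunc_def E_def fun_eq_iff)
    define Dw where "Dw x = (LINT t|?J. E t *\<^sub>R Du t x)" for x
    have "(LINT x|lebesgue. (\<sigma> x *v Dw x) \<bullet> g x) + \<tau>\<^sup>2 * (LINT x|lebesgue. laplace_trunc T u \<tau> x * \<phi> x)
        = (LINT x|lebesgue. f x * \<phi> x) - exp (- \<tau> * T) * (V T \<phi> + \<tau> * (LINT x|lebesgue. U T x * \<phi> x))"
      if \<phi>: "H1 \<phi> g" for \<phi> g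
    proof -
      have L2: "L2_fun lebesgue \<phi>" "L2_fun lebesgue (\<lambda>x. s x *\<^sub>R g x)"
        using \<phi> isotropic_L2_fun[OF \<sigma>] by (auto simp: H1_def)
      define h where "h t = (LINT x|lebesgue. u t x * \<phi> x)" for t
      define k where "k t = (LINT x|lebesgue. u' t x * \<phi> x)" for t
      define l where "l t = - (LINT x|lebesgue. Du t x \<bullet> (s x *\<^sub>R g x))" for t
      have int: "integrable ?J k" "integrable ?J l"
        using L2_L2_pairing(1)[OF u'(1) L2(1)] L2_L2_pairing(1)[OF u2(2) L2(2)]
        by (simp_all add: k_def[abs_def] l_def[abs_def])
      \<comment> \<open>The equation replaces the second time derivative by an explicit pairing,
        whose integrability in time comes from \<open>Du\<close>.\<close>
      have ul: "AE t in ?J. u'' t \<phi> = l t"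
        using eq by eventually_elim (use \<phi> isotropic_form[OF \<sigma>] in \<open>fastforce simp: l_def\<close>)
      \<comment> \<open>First integration by parts, from the second time derivative to the first:
        the dual-valued representative gives the value at T and, at 0, the source f.\<close>
      have kl: "(LINT t|?J. E t * l t) = E T * V T \<phi> - E 0 * V 0 \<phi> - (LINT t|?J. deriv E t * k t)"
      proof (rule weak_derivative_integration_by_parts[OF T _ _ int(2) E(2)])
        show "continuous_on {0..T} (\<lambda>t. V t \<phi>)"
          by (rule continuous_on_pairing_H1_dual[OF V Vlim \<phi>])
        show "AE t in ?J. V t \<phi> = k t"
          using Vu by eventually_elim (use \<phi> in \<open>auto simp: k_def\<close>)
        fix \<psi> assume \<psi>: "test_function {0<..<T} \<psi>"
        have "(LINT t|?J. deriv \<psi> t * k t) = - (LINT t|?J. \<psi> t * u'' t \<phi>)"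
          using u'' \<psi> \<phi> unfolding weak_time_deriv_H1_dual_def k_def by blast
        also have "(LINT t|?J. \<psi> t * u'' t \<phi>) = (LINT t|?J. \<psi> t * l t)"
          using ul by (intro integral_lebesgue_on_cong_AE) (auto elim: eventually_mono)
        finally show "(LINT t|?J. deriv \<psi> t * k t) = - (LINT t|?J. \<psi> t * l t)" .
      qed
      \<comment> \<open>Second integration by parts, down to \<open>u\<close>. Here the weak
        derivative is an identity for almost every x, so it is first paired with \<phi> by
        Fubini.\<close>
      have hk: "(LINT t|?J. E t * k t) = E T * (LINT x|lebesgue. U T x * \<phi> x)
          - E 0 * (LINT x|lebesgue. U 0 x * \<phi> x) - (LINT t|?J. deriv E t * h t)"
      proof (rule weak_derivative_integration_by_parts[OF T _ _ int(1) E(2)])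
        show "continuous_on {0..T} (\<lambda>t. LINT x|lebesgue. U t x * \<phi> x)"
          by (rule continuous_on_pairing_L2[OF U Ulim L2(1)])
        show "AE t in ?J. (LINT x|lebesgue. U t x * \<phi> x) = h t"
          using Uu
        proof eventually_elim
          case (elim t)
          then show ?case
            unfolding h_def by (intro integral_lebesgue_cong_AE) (auto elim: eventually_mono)
        qed
        fix \<psi> assume \<psi>: "test_function {0<..<T} \<psi>"
        then have C: "C_k 0 \<psi>" "C_k (Suc 0) \<psi>"
          unfolding test_function_def by blast+
        have cont: "continuous_on UNIV \<psi>" "continuous_on UNIV (deriv \<psi>)"
          using C unfolding C_k_Suc_real by simp_all
        have "(LINT t|?J. deriv \<psi> t * h t) = (LINT x|lebesgue. (LINT t|?J. deriv \<psi> t * u t x) * \<phi> x)"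
          using L2_L2_pairing(2)[OF u2(1) L2(1) cont(2)] by (simp add: h_def)
        also have "\<dots> = (LINT x|lebesgue. - ((LINT t|?J. \<psi> t * u' t x) * \<phi> x))"
        proof (rule integral_lebesgue_cong_AE)
          have "AE x in lebesgue. (LINT t|?J. deriv \<psi> t * u t x) = - (LINT t|?J. \<psi> t * u' t x)"
            using u'(2) \<psi> unfolding weak_time_deriv_L2_def by blast
          then show "AE x in lebesgue. (LINT t|?J. deriv \<psi> t * u t x) * \<phi> x = - ((LINT t|?J. \<psi> t * u' t x) * \<phi> x)"
            by eventually_elim simp
        qed
        also have "\<dots> = - (LINT t|?J. \<psi> t * k t)"
          using L2_L2_pairing(2)[OF u'(1) L2(1) cont(1)] by (simp add: k_def)
        finally show "(LINT t|?J. deriv \<psi> t * h t) = - (LINT t|?J. \<psi> t * k t)" .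
      qed
      have "(LINT x|lebesgue. U 0 x * \<phi> x) = 0"
        by (rule integral_eq_zero_AE) (use U0 in \<open>auto elim: eventually_mono\<close>)
      then have hk': "(LINT t|?J. E t * k t) = E T * (LINT x|lebesgue. U T x * \<phi> x) + \<tau> * (LINT t|?J. E t * h t)"
        using hk unfolding E' by (simp add: mult.assoc)
      have "V 0 \<phi> = (LINT x|lebesgue. f x * \<phi> x)"
        using V0 \<phi> by blast
      then have kl': "(LINT t|?J. E t * l t) = E T * V T \<phi> - (LINT x|lebesgue. f x * \<phi> x) + \<tau> * (LINT t|?J. E t * k t)"
        using kl unfolding E' by (simp add: mult.assoc E_def)
      have "(LINT t|?J. E t * l t) = - (LINT x|lebesgue. Dw x \<bullet> (s x *\<^sub>R g x))"
        using L2_L2_pairing(2)[OF u2(2) L2(2) E(1)] by (simp add: l_def Dw_def)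
      then have l: "(LINT t|?J. E t * l t) = - (LINT x|lebesgue. (\<sigma> x *v Dw x) \<bullet> g x)"
        by (simp only: isotropic_form[OF \<sigma>])
      have h: "(LINT t|?J. E t * h t) = (LINT x|lebesgue. laplace_trunc T u \<tau> x * \<phi> x)"
        using L2_L2_pairing(2)[OF u2(1) L2(1) E(1)] by (simp add: h_def w)
      show ?thesis
        \<comment> \<open>Eliminating the integral of \<open>k\<close> multiplies the two factors
          \<tau> from differentiating the weight into \<tau>^2.\<close>
        using kl' unfolding l hk' h by (simp add: E_def algebra_simps power2_eq_square)
    qed
    moreover have "H1 (laplace_trunc T u \<tau>) Dw"
      unfolding w Dw_def[abs_def] by (rule H1_time_integral[OF Du E(1)])
    ultimately show "\<exists>Dw. H1 (laplace_trunc T u \<tau>) Dw \<and> (\<forall>\<phi> g. H1 \<phi> g \<longrightarrow>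
        (LINT x|lebesgue. (\<sigma> x *v Dw x) \<bullet> g x) + \<tau>\<^sup>2 * (LINT x|lebesgue. laplace_trunc T u \<tau> x * \<phi> x)
        = (LINT x|lebesgue. f x * \<phi> x) - exp (- \<tau> * T) * (V T \<phi> + \<tau> * (LINT x|lebesgue. U T x * \<phi> x)))"
      by blast
  qed
qed

text \<open>Testing with the solution itself.  Since the \<open>H\<^sup>1\<close> norm is controlled by the energy, a
  right-hand side in the dual of \<open>H\<^sup>1\<close> still gains one power of \<open>\<tau>\<close> in \<open>L\<^sup>2\<close>.\<close>

lemma elliptic_L2_estimate:
  assumes \<sigma>: "isotropic \<sigma> s c B" and V: "H1_dual V" and U: "L2_fun lebesgue U"
  obtains C where "0 \<le> C" "\<And>\<tau> e z Dz. \<tau> \<ge> 1 \<Longrightarrow> 0 \<le> e \<Longrightarrow> H1 z Dz \<Longrightarrow>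
     (LINT x|lebesgue. (\<sigma> x *v Dz x) \<bullet> Dz x) + \<tau>\<^sup>2 * (LINT x|lebesgue. z x * z x)
       = - (e * (V z + \<tau> * (LINT x|lebesgue. U x * z x))) \<Longrightarrow>
     L2_norm z \<le> C * e / \<tau>"
proof -
  obtain K0 where K0: "\<And>\<phi> g. H1 \<phi> g \<Longrightarrow> \<bar>V \<phi>\<bar> \<le> K0 * H1_norm \<phi> g"
    using V unfolding H1_dual_def by blast
  define K where "K = \<bar>K0\<bar>"
  define M where "M = K + L2_norm U"
  \<comment> \<open>The sum of the two Young remainders below. Half of
    \<open>(\<tau> * a)\<^sup>2\<close> is absorbed on the left, so both are doubled: M^2 / 2
    becomes M^2 and K^2 / (4 c) becomes K^2 / (2 c).\<close>
  define Q where "Q = M\<^sup>2 + K\<^sup>2 / (2 * c)"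
  have c: "c > 0" using \<sigma> by (simp add: isotropic_def)
  have Q0: "Q \<ge> 0" using c by (simp add: Q_def)
  have K: "0 \<le> K" by (simp add: K_def)
  show thesis
  proof (rule that[of "sqrt Q"])
    show "0 \<le> sqrt Q" using Q0 by simp
    fix \<tau> e z Dz
    assume \<tau>: "\<tau> \<ge> (1::real)" and e: "0 \<le> (e::real)" and z: "H1 z Dz"
      and eq: "(LINT x|lebesgue. (\<sigma> x *v Dz x) \<bullet> Dz x) + \<tau>\<^sup>2 * (LINT x|lebesgue. z x * z x)
       = - (e * (V z + \<tau> * (LINT x|lebesgue. U x * z x)))"
    define a where "a = L2_norm z"
    define d where "d = sqrt (LINT x|lebesgue. (norm (Dz x))\<^sup>2)"
    have a0: "a \<ge> 0" and d0: "d \<ge> 0"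
      by (simp_all add: a_def d_def L2_norm_nonneg)
    have a2: "a\<^sup>2 = (LINT x|lebesgue. z x * z x)"
      using L2_norm_power2[of z] by (simp add: a_def power2_eq_square)
    have d2: "d\<^sup>2 = (LINT x|lebesgue. (norm (Dz x))\<^sup>2)"
      by (simp add: d_def)
    have L2: "L2_fun lebesgue z" "L2_fun lebesgue Dz"
      using z by (auto simp: H1_def)
    have "c * d\<^sup>2 = (LINT x|lebesgue. c * (norm (Dz x))\<^sup>2)"
      by (simp add: d2)
    also have "\<dots> \<le> (LINT x|lebesgue. Dz x \<bullet> (s x *\<^sub>R Dz x))"
    proof (rule integral_mono_AE)
      show "integrable lebesgue (\<lambda>x. c * (norm (Dz x))\<^sup>2)"
        using L2 by (simp add: L2_fun_def)
      show "integrable lebesgue (\<lambda>x. Dz x \<bullet> (s x *\<^sub>R Dz x))"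
        by (rule L2_fun_inner[OF L2(2) isotropic_L2_fun[OF \<sigma> L2(2)]])
      have "AE x in lebesgue. c \<le> s x"
        using \<sigma> by (auto simp: isotropic_def elim: eventually_mono)
      then show "AE x in lebesgue. c * (norm (Dz x))\<^sup>2 \<le> Dz x \<bullet> (s x *\<^sub>R Dz x)"
        by eventually_elim (simp add: power2_norm_eq_inner mult_right_mono)
    qed
    finally have coer: "c * d\<^sup>2 + \<tau>\<^sup>2 * a\<^sup>2 \<le> - (e * (V z + \<tau> * (LINT x|lebesgue. U x * z x)))"
      using eq by (simp add: isotropic_form[OF \<sigma>] a2)
    have "H1_norm z Dz = sqrt (a\<^sup>2 + d\<^sup>2)"
      by (simp add: H1_norm_def d2 a_def L2_norm_power2)
    also have "\<dots> \<le> a + d"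
      using a0 d0 by (rule sqrt_sum_squares_le_sum)
    finally have "K0 * H1_norm z Dz \<le> K * (a + d)"
      unfolding K_def using H1_norm_nonneg[of z Dz] by (intro mult_mono) auto
    then have "\<bar>V z\<bar> \<le> K * (a + d)"
      using K0[OF z] by simp
    moreover have "\<bar>LINT x|lebesgue. U x * z x\<bar> \<le> L2_norm U * a"
      unfolding a_def by (rule L2_norm_Cauchy_Schwarz[OF U L2(1)])
    then have "\<tau> * \<bar>LINT x|lebesgue. U x * z x\<bar> \<le> \<tau> * (L2_norm U * a)"
      using \<tau> by (intro mult_left_mono) auto
    \<comment> \<open>The zeroth-order part of the functional has no factor \<tau>; by \<tau> \<ge>
      1 it is merged into the term with \<tau> a.\<close>
    moreover have "K * a \<le> K * (\<tau> * a)"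
      using \<tau> a0 K by (intro mult_left_mono) (auto simp: mult_le_cancel_right1)
    moreover have "- (\<tau> * (LINT x|lebesgue. U x * z x)) \<le> \<tau> * \<bar>LINT x|lebesgue. U x * z x\<bar>"
      using \<tau> mult_left_mono[of "- (LINT x|lebesgue. U x * z x)" "\<bar>LINT x|lebesgue. U x * z x\<bar>" \<tau>] by simp
    ultimately have "- (V z + \<tau> * (LINT x|lebesgue. U x * z x)) \<le> M * (\<tau> * a) + K * d"
      unfolding M_def by (simp add: algebra_simps)
    then have "e * - (V z + \<tau> * (LINT x|lebesgue. U x * z x)) \<le> e * (M * (\<tau> * a) + K * d)"
      using e by (rule mult_left_mono)
    with coer have "c * d\<^sup>2 + (\<tau> * a)\<^sup>2 \<le> (e * M) * (\<tau> * a) + (e * K) * d"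
      by (simp add: algebra_simps)
    moreover have "(e * M) * (\<tau> * a) \<le> (\<tau> * a)\<^sup>2 / 2 + (e * M)\<^sup>2 / 2"
      using sum_squares_bound[of "e * M" "\<tau> * a"] by simp
    \<comment> \<open>Young's inequality weighted so that the gradient term cancels exactly against
      the ellipticity bound.\<close>
    moreover have "(e * K) * d \<le> c * d\<^sup>2 + (e * K)\<^sup>2 / (4 * c)"
    proof -
      have "0 \<le> (2 * c * d - e * K)\<^sup>2 / (4 * c)"
        using c by simp
      also have "\<dots> = c * d\<^sup>2 + (e * K)\<^sup>2 / (4 * c) - (e * K) * d"
        using c by (simp add: field_simps power2_eq_square)
      finally show ?thesis by simp
    qed
    ultimately have "(\<tau> * a)\<^sup>2 \<le> (e * M)\<^sup>2 + 2 * ((e * K)\<^sup>2 / (4 * c))"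
      by linarith
    also have "\<dots> = e\<^sup>2 * Q"
      using c by (simp add: Q_def field_simps power_mult_distrib)
    finally have "sqrt ((\<tau> * a)\<^sup>2) \<le> sqrt (e\<^sup>2 * Q)"
      by (rule real_sqrt_le_mono)
    then have "\<tau> * a \<le> e * sqrt Q"
      using \<tau> a0 e by (simp add: real_sqrt_mult)
    then show "L2_norm z \<le> sqrt Q * e / \<tau>"
      using \<tau> by (simp add: a_def field_simps)
  qed
qed

section \<open>Comparison of the two indicator functions\<close>

lemma laplace_trunc_L2:
  assumes "weak_wave_solution \<sigma> T f u"
  shows "L2_fun lebesgue (laplace_trunc T u \<tau>)"
proof -
  have "L2_L2 T u"
    using assms by (auto simp: weak_wave_solution_def L2_H1_def)
  from L2_L2_time_integral[OF this, of "\<lambda>t. exp (- \<tau> * t)"] show ?thesis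
    by (simp add: laplace_trunc_def[abs_def] continuous_intros)
qed

text \<open>In the definition the spatial integral is inside. At almost every time both slices are
  square integrable, so it splits, and Fubini then applies to \<open>u\<close> and \<open>u0\<close>
  separately.\<close>

lemma indicator_I_tilde_eq:
  assumes u: "L2_L2 T u" and u0: "L2_L2 T u0" and f: "L2_fun lebesgue f"
  shows "indicator_I_tilde f T u u0 \<tau>
    = (LINT x|lebesgue. f x * laplace_trunc T u \<tau> x) - (LINT x|lebesgue. f x * laplace_trunc T u0 \<tau> x)"
proof -
  let ?J = "lebesgue_on {0<..<T}"
  let ?E = "\<lambda>t. exp (- \<tau> * t)"
  have E: "continuous_on UNIV ?E"
    by (intro continuous_intros)
  have "indicator_I_tilde f T u u0 \<tau>
    = (LINT t|?J. ?E t * (LINT x|lebesgue. u t x * f x) - ?E t * (LINT x|lebesgue. u0 t x * f x))"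
    unfolding indicator_I_tilde_def
  proof (rule integral_lebesgue_on_cong_AE)
    show "AE t in ?J. (LINT x|lebesgue. ?E t * f x * (u t x - u0 t x))
        = ?E t * (LINT x|lebesgue. u t x * f x) - ?E t * (LINT x|lebesgue. u0 t x * f x)"
      using L2_L2_slice[OF u] L2_L2_slice[OF u0]
    proof eventually_elim
      case (elim t)
      have "(LINT x|lebesgue. ?E t * f x * (u t x - u0 t x))
        = (LINT x|lebesgue. ?E t * (u t x * f x) - ?E t * (u0 t x * f x))"
        by (simp add: algebra_simps)
      also have "\<dots> = ?E t * (LINT x|lebesgue. u t x * f x) - ?E t * (LINT x|lebesgue. u0 t x * f x)"
        using L2_fun_mult[OF elim(1) f] L2_fun_mult[OF elim(2) f] by simp
      finally show ?case .
    qed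
  qed simp
  also have "\<dots> = (LINT t|?J. ?E t * (LINT x|lebesgue. u t x * f x)) - (LINT t|?J. ?E t * (LINT x|lebesgue. u0 t x * f x))"
    using L2_L2_pairing(1)[OF u f] L2_L2_pairing(1)[OF u0 f]
    by (intro Bochner_Integration.integral_diff integrable_mult_continuous_interval[OF E]) simp_all
  finally show ?thesis
    using L2_L2_pairing(2)[OF u f E] L2_L2_pairing(2)[OF u0 f E]
    by (simp add: laplace_trunc_def mult.commute)
qed

theorem proposition5p1:
  fixes \<gamma>0 \<gamma> :: "real^3 \<Rightarrow> real^3^3"
    and D B :: "(real^3) set"
    and f :: "real^3 \<Rightarrow> real"
    and T :: real
    and u u0 v :: "real \<Rightarrow> real^3 \<Rightarrow> real"
  assumes "0 < T"
    and "conductivity \<gamma>"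
    and "D \<noteq> {}" and "bounded D" and "D \<in> sets lebesgue"
    and "non_layered_setting \<gamma>0 \<gamma> D B \<or> two_layered_setting \<gamma>0 \<gamma> D B"
    and "source B f"
    and "weak_wave_solution \<gamma> T f u"
    and "weak_wave_solution \<gamma>0 T f u0"
    and "\<And>\<tau>. \<tau> \<ge> 1 \<Longrightarrow> weak_elliptic_solution \<gamma>0 \<tau> f (v \<tau>)"
  shows "\<exists>C>0. \<forall>\<tau>\<ge>1.
    \<bar>indicator_I_tilde f T u u0 \<tau> - indicator_I f T u v \<tau>\<bar>
      \<le> C * inverse \<tau> * exp (- \<tau> * T) * (L2_norm f)\<^sup>2"
proof -
  have f: "L2_fun lebesgue f"
    using assms(7) by (simp add: source_def)
  obtain s c K where \<sigma>: "isotropic \<gamma>0 s c K"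
    using assms(6) by (rule background_isotropic)
  obtain V U where V: "H1_dual V" and U: "L2_fun lebesgue U"
    and lap: "\<And>\<tau>. \<exists>Dw. H1 (laplace_trunc T u0 \<tau>) Dw \<and> (\<forall>\<phi> g. H1 \<phi> g \<longrightarrow>
        (LINT x|lebesgue. (\<gamma>0 x *v Dw x) \<bullet> g x) + \<tau>\<^sup>2 * (LINT x|lebesgue. laplace_trunc T u0 \<tau> x * \<phi> x)
        = (LINT x|lebesgue. f x * \<phi> x) - exp (- \<tau> * T) * (V \<phi> + \<tau> * (LINT x|lebesgue. U x * \<phi> x)))"
    using wave_laplace_trunc[OF assms(1) \<sigma> assms(9)] by blast
  obtain C where C: "0 \<le> C" and est: "\<And>\<tau> e z Dz. \<tau> \<ge> 1 \<Longrightarrow> 0 \<le> e \<Longrightarrow> H1 z Dz \<Longrightarrow>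
     (LINT x|lebesgue. (\<gamma>0 x *v Dz x) \<bullet> Dz x) + \<tau>\<^sup>2 * (LINT x|lebesgue. z x * z x)
       = - (e * (V z + \<tau> * (LINT x|lebesgue. U x * z x))) \<Longrightarrow>
     L2_norm z \<le> C * e / \<tau>"
    using elliptic_L2_estimate[OF \<sigma> V U] by blast
  have bound: "\<bar>indicator_I_tilde f T u u0 \<tau> - indicator_I f T u v \<tau>\<bar>
      \<le> L2_norm f * (C * exp (- \<tau> * T) / \<tau>)" if \<tau>: "\<tau> \<ge> 1" for \<tau>
  proof -
    let ?w = "laplace_trunc T u \<tau>" and ?y = "laplace_trunc T u0 \<tau>"
    obtain Dv where Dv: "H1 (v \<tau>) Dv" and v: "\<And>\<phi> g. H1 \<phi> g \<Longrightarrow>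
        - (LINT x|lebesgue. (\<gamma>0 x *v Dv x) \<bullet> g x) - \<tau>\<^sup>2 * (LINT x|lebesgue. v \<tau> x * \<phi> x)
          + (LINT x|lebesgue. f x * \<phi> x) = 0"
      using assms(10)[OF \<tau>] unfolding weak_elliptic_solution_def by blast
    obtain Dw where Dw: "H1 ?y Dw" and w: "\<And>\<phi> g. H1 \<phi> g \<Longrightarrow>
        (LINT x|lebesgue. (\<gamma>0 x *v Dw x) \<bullet> g x) + \<tau>\<^sup>2 * (LINT x|lebesgue. ?y x * \<phi> x)
        = (LINT x|lebesgue. f x * \<phi> x) - exp (- \<tau> * T) * (V \<phi> + \<tau> * (LINT x|lebesgue. U x * \<phi> x))"
      using lap[of \<tau>] by blast
    define z where "z x = ?y x - v \<tau> x" for x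
    define Dz where "Dz x = Dw x - Dv x" for x
    have z: "H1 z Dz"
      unfolding z_def[abs_def] Dz_def[abs_def] by (rule H1_diff[OF Dw Dv])
    have L2: "L2_fun lebesgue z" "L2_fun lebesgue Dz" "L2_fun lebesgue (v \<tau>)" "L2_fun lebesgue Dv"
      "L2_fun lebesgue ?y" "L2_fun lebesgue Dw" "L2_fun lebesgue ?w"
      using z Dv Dw laplace_trunc_L2[OF assms(8)] by (auto simp: H1_def)
    \<comment> \<open>Only the first slot is split, so that both weak equations are used with the
      same test function \<open>z\<close> and the source terms cancel.\<close>
    have "(LINT x|lebesgue. (\<gamma>0 x *v Dz x) \<bullet> Dz x)
        = (LINT x|lebesgue. (\<gamma>0 x *v Dw x) \<bullet> Dz x) - (LINT x|lebesgue. (\<gamma>0 x *v Dv x) \<bullet> Dz x)"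
      unfolding isotropic_form[OF \<sigma>] Dz_def inner_diff_left
      using L2_fun_inner[OF L2(6) isotropic_L2_fun[OF \<sigma> L2(2)]] L2_fun_inner[OF L2(4) isotropic_L2_fun[OF \<sigma> L2(2)]]
      by (simp add: Dz_def)
    moreover have "(LINT x|lebesgue. z x * z x) = (LINT x|lebesgue. ?y x * z x) - (LINT x|lebesgue. v \<tau> x * z x)"
      using L2_fun_mult[OF L2(5,1)] L2_fun_mult[OF L2(3,1)] by (simp add: z_def left_diff_distrib)
    ultimately have "(LINT x|lebesgue. (\<gamma>0 x *v Dz x) \<bullet> Dz x) + \<tau>\<^sup>2 * (LINT x|lebesgue. z x * z x)
       = - (exp (- \<tau> * T) * (V z + \<tau> * (LINT x|lebesgue. U x * z x)))"
      using v[OF z] w[OF z] by (simp add: right_diff_distrib)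
    then have "L2_norm z \<le> C * exp (- \<tau> * T) / \<tau>"
      by (intro est[OF \<tau> _ z]) simp_all
    have "u \<in> {u. L2_L2 T u}" "u0 \<in> {u. L2_L2 T u}"
      using assms(8,9) by (auto simp: weak_wave_solution_def L2_H1_def)
    then have "indicator_I_tilde f T u u0 \<tau> - indicator_I f T u v \<tau>
        = (LINT x|lebesgue. f x * v \<tau> x) - (LINT x|lebesgue. f x * ?y x)"
      using indicator_I_tilde_eq[OF _ _ f, of T u u0 \<tau>] L2_fun_mult[OF f L2(7)] L2_fun_mult[OF f L2(3)]
      by (simp add: indicator_I_def right_diff_distrib)
    also have "\<dots> = - (LINT x|lebesgue. f x * z x)"
      using L2_fun_mult[OF f L2(5)] L2_fun_mult[OF f L2(3)] by (simp add: z_def right_diff_distrib)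
    finally have "\<bar>indicator_I_tilde f T u u0 \<tau> - indicator_I f T u v \<tau>\<bar> \<le> L2_norm f * L2_norm z"
      using L2_norm_Cauchy_Schwarz[OF f L2(1)] by simp
    also have "\<dots> \<le> L2_norm f * (C * exp (- \<tau> * T) / \<tau>)"
      by (intro mult_left_mono L2_norm_nonneg) fact
    finally show ?thesis .
  qed
  show ?thesis
  \<comment> \<open>\<open>bound\<close> has one factor \<open>L2_norm f\<close>, the claim has two.
    If the norm is 0 both right-hand sides vanish and any positive constant serves.\<close>
  proof (cases "L2_norm f = 0")
    case True
    then show ?thesis
      using bound by (intro exI[of _ 1]) auto
  next
    case False
    then have N: "L2_norm f > 0"
      using L2_norm_nonneg[of f] by linarith
    show ?thesis
    \<comment> \<open>The division supplies the second factor of the norm; the summand 1 makes the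
      constant positive even if \<open>C\<close> is 0.\<close>
    proof (intro exI[of _ "C / L2_norm f + 1"] conjI allI impI)
      show "C / L2_norm f + 1 > 0"
        using C N by (simp add: add_nonneg_pos)
      fix \<tau> :: real assume \<tau>: "\<tau> \<ge> 1"
      have "L2_norm f * (C * exp (- \<tau> * T) / \<tau>) = C / L2_norm f * inverse \<tau> * exp (- \<tau> * T) * (L2_norm f)\<^sup>2"
        using N by (simp add: field_simps power2_eq_square)
      also have "\<dots> \<le> (C / L2_norm f + 1) * inverse \<tau> * exp (- \<tau> * T) * (L2_norm f)\<^sup>2"
        using \<tau> by (intro mult_right_mono) auto
      finally show "\<bar>indicator_I_tilde f T u u0 \<tau> - indicator_I f T u v \<tau>\<bar>
          \<le> (C / L2_norm f + 1) * inverse \<tau> * exp (- \<tau> * T) * (L2_norm f)\<^sup>2"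
        using bound[OF \<tau>] by linarith
    qed
  qed
qed

end
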